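(* For every $\sigma>0$, the level spacing distribution of the desymmetrized Robin spectrum on the hemisphere is a delta function at the origin: for every bounded continuous $f:[0,\infty)\to\mathbb R$, $$\lim_{N\to\infty}\frac1N\sum_{n=1}^{N} f\left(\frac{\lambda_{n+1}(\sigma)-\lambda_n(\sigma)}{\overline{s}_N}\right)=f(0),\qquad \overline{s}_N=\frac1N\sum_{n=1}^N\big(\lambda_{n+1}(\sigma)-\lambda_n(\sigma)\big).$$
   Context: Let $\Omega$ be the closed upper unit hemisphere in $\mathbb R^3$ with coordinates $(\sin\theta\cos\phi,\sin\theta\sin\phi,\cos\theta)$, $0\le\theta\le\pi/2$, $0\le \phi<2\pi$, and boundary the equator $\theta=\pi/2$. For a constant $\sigma>0$ the Robin problem is $\Delta F+\lambda F=0$ in $\Omega$, $\frac{\partial F}{\partial n}+\sigma F=0$ on $\partial\Omega$, where $\Delta$ is the Laplace-Beltrami operator and $\partial/\partial n$ the outward normal derivative. It separates into sectors of functions $F=e^{im\phi}f(\cos\theta)$, $m\in\mathbb Z$; since $\pm m$ give the same eigenvalues, the desymmetrized spectrum keeps only the eigenvalues of sectors with $m\ge0$ (an eigenvalue is counted once for each $m\ge 0$ for which it has a nonzero eigenfunction in sector $m$). Let $\lambda_0(\sigma)\le\lambda_1(\sigma)\le\cdots$ be the ordered desymmetrized Robin eigenvalues, repeated with multiplicity. The level spacing distribution is the limiting distribution (if it exists) of the nearest-neighbour gaps $\lambda_{n+1}(\sigma)-\lambda_n(\sigma)$, $n\le N$, normalized to have mean unity, as $N\to\infty$. *)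

theory Defs
  imports "HOL-Analysis.Analysis"
begin

definition hemisphere :: "(real ^ 3) set" where
  "hemisphere = {x. norm x = 1 \<and> 0 \<le> x $ 3}"

definition sph :: "real \<Rightarrow> real \<Rightarrow> real ^ 3" where
  "sph \<theta> \<phi> = vector [sin \<theta> * cos \<phi>, sin \<theta> * sin \<phi>, cos \<theta>]"

definition C2_on :: "('a::real_normed_vector) set \<Rightarrow> ('a \<Rightarrow> 'b::real_normed_vector) \<Rightarrow> bool" where
  "C2_on U G \<longleftrightarrow> (\<exists>(G' :: 'a \<Rightarrow> 'a \<Rightarrow>\<^sub>L 'b) (G'' :: 'a \<Rightarrow> 'a \<Rightarrow>\<^sub>L ('a \<Rightarrow>\<^sub>L 'b)).
     (\<forall>x\<in>U. (G has_derivative blinfun_apply (G' x)) (at x)) \<and>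
     (\<forall>x\<in>U. (G' has_derivative blinfun_apply (G'' x)) (at x)) \<and>
     continuous_on U G'')"

text \<open>Regularity up to the boundary (and through the pole), expressed by extension to an open
  subset of the ambient space.\<close>
definition C2_hemisphere :: "(real ^ 3 \<Rightarrow> complex) \<Rightarrow> bool" where
  "C2_hemisphere F \<longleftrightarrow> (\<exists>U G. open U \<and> hemisphere \<subseteq> U \<and> C2_on U G \<and> (\<forall>x\<in>hemisphere. F x = G x))"

text \<open>The Laplace-Beltrami operator of the round metric
  \<open>d\<theta>\<^sup>2 + sin\<^sup>2 \<theta> d\<phi>\<^sup>2\<close>, evaluated at the point \<open>sph \<theta> \<phi>\<close>:
  \<open>(1 / sin \<theta>) \<partial>\<^sub>\<theta> (sin \<theta> \<partial>\<^sub>\<theta> F) + (1 / sin\<^sup>2 \<theta>) \<partial>\<^sub>\<phi>\<^sup>2 F\<close>.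
  The formula is meaningful for \<open>0 < \<theta> < \<pi>\<close>, that is, away from the poles.\<close>
definition laplace_beltrami :: "(real ^ 3 \<Rightarrow> complex) \<Rightarrow> real \<Rightarrow> real \<Rightarrow> complex" where
  "laplace_beltrami F \<theta> \<phi> =
     vector_derivative
       (\<lambda>t. sin t *\<^sub>R vector_derivative (\<lambda>s. F (sph s \<phi>)) (at t)) (at \<theta>) /\<^sub>R sin \<theta>
     + vector_derivative
       (\<lambda>t. vector_derivative (\<lambda>s. F (sph \<theta> s)) (at t)) (at \<phi>) /\<^sub>R (sin \<theta>)\<^sup>2"

text \<open>The outward unit normal to the hemisphere at the equator point \<open>sph (\<pi>/2) \<phi>\<close> is
  \<open>\<partial>\<^sub>\<theta> sph = (0, 0, -1)\<close>; the derivative is one-sided, from inside the hemisphere.\<close>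
definition normal_derivative :: "(real ^ 3 \<Rightarrow> complex) \<Rightarrow> real \<Rightarrow> complex" where
  "normal_derivative F \<phi> =
     vector_derivative (\<lambda>\<theta>. F (sph \<theta> \<phi>)) (at (pi / 2) within {0..pi / 2})"

text \<open>Classical solutions that do not vanish identically. The equation is imposed in the
  interior off the pole \<open>\<theta> = 0\<close>; since \<open>F\<close> is twice continuously differentiable on the closed
  hemisphere, it then holds at the pole and on the equator by continuity.\<close>
definition robin_eigenfunction :: "real \<Rightarrow> real \<Rightarrow> (real ^ 3 \<Rightarrow> complex) \<Rightarrow> bool" where
  "robin_eigenfunction \<sigma> \<mu> F \<longleftrightarrow>
     C2_hemisphere F \<and>
     (\<exists>x\<in>hemisphere. F x \<noteq> 0) \<and>
     (\<forall>\<theta> \<phi>. 0 < \<theta> \<and> \<theta> < pi / 2 \<longrightarrow> laplace_beltrami F \<theta> \<phi> + of_real \<mu> * F (sph \<theta> \<phi>) = 0) \<and>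
     (\<forall>\<phi>. normal_derivative F \<phi> + of_real \<sigma> * F (sph (pi / 2) \<phi>) = 0)"

definition in_sector :: "int \<Rightarrow> (real ^ 3 \<Rightarrow> complex) \<Rightarrow> bool" where
  "in_sector m F \<longleftrightarrow> (\<exists>f :: real \<Rightarrow> complex.
     \<forall>\<theta>\<in>{0..pi / 2}. \<forall>\<phi>. F (sph \<theta> \<phi>) = exp (\<i> * of_int m * of_real \<phi>) * f (cos \<theta>))"

text \<open>Tagging each eigenvalue with its sector records the multiplicity: \<open>\<mu>\<close> occurs once
  for each \<open>m \<ge> 0\<close> admitting an eigenfunction.\<close>
definition desym_robin_spectrum :: "real \<Rightarrow> (real \<times> int) set" where
  "desym_robin_spectrum \<sigma> =
     {(\<mu>, m). 0 \<le> m \<and> (\<exists>F. robin_eigenfunction \<sigma> \<mu> F \<and> in_sector m F)}"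

definition ordered_listing :: "(real \<times> 'a) set \<Rightarrow> (nat \<Rightarrow> real) \<Rightarrow> bool" where
  "ordered_listing S l \<longleftrightarrow> mono l \<and> (\<exists>e. bij_betw e (UNIV :: nat set) S \<and> (\<forall>n. l n = fst (e n)))"

lemma ordered_listing_le:
  assumes "ordered_listing S l" "ordered_listing S l'"
  shows "l' n \<le> l n"
proof (rule ccontr)
  assume less: "\<not> l' n \<le> l n"
  obtain e where e: "bij_betw e UNIV S" "\<And>n. l n = fst (e n)"
    using assms(1) by (auto simp: ordered_listing_def)
  obtain e' where e': "bij_betw e' UNIV S" "\<And>n. l' n = fst (e' n)"
    using assms(2) by (auto simp: ordered_listing_def)
  have mono: "mono l" "mono l'"
    using assms by (auto simp: ordered_listing_def)
  have "e ` {..n} \<subseteq> e' ` {..<n}"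
  proof
    fix p assume "p \<in> e ` {..n}"
    then obtain k where k: "k \<le> n" "p = e k" by auto
    have "p \<in> range e'" using e(1) e'(1) k(2) by (auto simp: bij_betw_def)
    then obtain j where j: "p = e' j" by auto
    have "l' j = l k" using e(2) e'(2) j k(2) by simp
    also have "\<dots> \<le> l n" using mono(1) k(1) by (simp add: monoD)
    finally have "l' j < l' n" using less by simp
    then have "j < n" using monoD[OF mono(2), of n j] by (meson not_le)
    then show "p \<in> e' ` {..<n}" using j by simp
  qed
  then have "card (e ` {..n}) \<le> card (e' ` {..<n})" by (simp add: card_mono)
  moreover have "card (e ` {..n}) = Suc n"
    using e(1) by (subst card_image) (auto simp: bij_betw_def intro: inj_on_subset)
  moreover have "card (e' ` {..<n}) \<le> n"
    using card_image_le[of "{..<n}" e'] by simp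
  ultimately show False by simp
qed

lemma ordered_listing_unique:
  assumes "ordered_listing S l" "ordered_listing S l'"
  shows "l = l'"
  using assms ordered_listing_le by (metis ext order_antisym)

text \<open>The definite description denotes as soon as a listing exists, by
  \<open>ordered_listing_unique\<close>.\<close>
definition robin_eigenvalue :: "real \<Rightarrow> nat \<Rightarrow> real" where
  "robin_eigenvalue \<sigma> = (THE l. ordered_listing (desym_robin_spectrum \<sigma>) l)"

definition robin_gap :: "real \<Rightarrow> nat \<Rightarrow> real" where
  "robin_gap \<sigma> n = robin_eigenvalue \<sigma> (Suc n) - robin_eigenvalue \<sigma> n"

definition mean_robin_gap :: "real \<Rightarrow> nat \<Rightarrow> real" where
  "mean_robin_gap \<sigma> N = (\<Sum>n = 1..N. robin_gap \<sigma> n) / real N"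

end

theory Submission
  imports Defs "HOL-Real_Asymp.Real_Asymp"
begin

text \<open>In the sector \<open>m\<close> the eigenvalue equation is the associated Legendre equation, whose solution regular
at the pole is \<open>sin\<^sup>m \<theta> w\<^sub>m(1 - cos \<theta>)\<close> with an explicit power series \<open>w\<^sub>m\<close>. A Wronskian argument shows that a
\<open>C\<^sup>2\<close> eigenfunction in the sector must be a multiple of it, so the eigenvalues of the sector are the
numbers \<open>\<mu>\<close> with \<open>B\<^sub>m(\<mu>) = \<sigma> A\<^sub>m(\<mu>)\<close>, where \<open>A\<^sub>m\<close> and \<open>B\<^sub>m\<close> are the value of this
solution and its slope with respect to \<open>cos \<theta>\<close> at the equator (\<open>desym_robin_spectrum_eq\<close>).

The roots are located by an exact formula. The ladder relations between the solutions for \<open>m\<close> and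
\<open>m + 1\<close> give, for \<open>\<mu> = \<nu>(\<nu> + 1)\<close> and \<open>q\<^sub>m = B\<^sub>m / A\<^sub>m\<close>, the recursion
\<open>q\<^sub>m q\<^sub>m\<^sub>+\<^sub>1 = (m + \<nu> + 1)(m - \<nu>)\<close>. It has only one solution with \<open>q\<^sub>m \<sim> - m\<close> as \<open>m \<rightarrow> \<infinity>\<close>, and a quotient of Gamma
values is such a solution. After reflection, with \<open>G(x) = \<Gamma>(x + 1/2) / \<Gamma>(x)\<close>, this reads
\<open>q\<^sub>m = 2 G((\<nu> + m + 1)/2) G((\<nu> - m + 1)/2) tan(\<pi>(\<nu> - m)/2)\<close>. Since \<open>G\<close> is positive and nondecreasing,
\<open>q\<^sub>m = \<sigma>\<close> has exactly one solution in each interval \<open>l < \<nu> < l + 1\<close> with \<open>l \<ge> m\<close> and \<open>l \<equiv> m (mod 2)\<close>,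
and no other (\<open>robin_root_exists_unique\<close>, \<open>robin_root_cluster\<close>). Since \<open>G(x)\<close> is of size \<open>\<surd>x\<close>, the
solution satisfies \<open>\<nu> - l = O(1/\<surd>l)\<close>, that is, \<open>\<mu> = l(l + 1) + O(\<surd>l)\<close> uniformly in \<open>m\<close>.

Hence the spectrum consists of clusters: the cluster \<open>l\<close> has about \<open>l/2\<close> members within distance
\<open>O(\<surd>l)\<close> above \<open>l(l + 1)\<close>. The first \<open>N\<close> eigenvalues meet \<open>O(\<surd>N)\<close> clusters, of total length
\<open>O(N\<^sup>3\<^sup>/\<^sup>4)\<close>. The sum of the truncated gaps \<open>min 1 (\<lambda>\<^sub>n\<^sub>+\<^sub>1 - \<lambda>\<^sub>n)\<close> is at most this length plus the number
of jumps between clusters, so it is \<open>o(N)\<close>, while the mean gap stays bounded below because \<open>\<lambda>\<^sub>N\<close> is at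
least of order \<open>N\<close>. Thus almost all normalized gaps are close to \<open>0\<close>, and the averages of a bounded
function that is continuous at \<open>0\<close> tend to \<open>f 0\<close> (\<open>average_tendsto_value_at_0\<close>).\<close>

section \<open>The Legendre solution regular at the pole\<close>

text \<open>Taylor coefficients at the pole, in the variable \<open>t = 1 - cos \<theta>\<close>, of the regular solution divided by
\<open>sin\<^sup>m \<theta>\<close>. It is the hypergeometric series \<open>F(m - \<nu>, m + \<nu> + 1; m + 1; t/2)\<close> for \<open>\<mu> = \<nu>(\<nu> + 1)\<close>.\<close>
primrec legendre_coeff :: "nat \<Rightarrow> real \<Rightarrow> nat \<Rightarrow> real" where
  "legendre_coeff m \<mu> 0 = 1"
| "legendre_coeff m \<mu> (Suc k) =
     (real (m + k) * real (m + k + 1) - \<mu>) / (2 * real (k + 1) * real (m + k + 1))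
       * legendre_coeff m \<mu> k"

definition legendre_fps :: "nat \<Rightarrow> real \<Rightarrow> real fps" where
  "legendre_fps m \<mu> = Abs_fps (legendre_coeff m \<mu>)"

definition legendre_sol :: "nat \<Rightarrow> real \<Rightarrow> real \<Rightarrow> real" where
  "legendre_sol m \<mu> = eval_fps (legendre_fps m \<mu>)"

text \<open>The factor that appears when differentiation turns the solution for \<open>m\<close> into the one for \<open>m + 1\<close>.\<close>
definition raising_const :: "nat \<Rightarrow> real \<Rightarrow> real" where
  "raising_const m \<mu> = (\<mu> - real m * (real m + 1)) / (2 * (real m + 1))"

lemma summable_legendre_coeff:
  assumes "\<bar>t\<bar> < 2"
  shows "summable (\<lambda>k. legendre_coeff m \<mu> k * t ^ k)"
proof -
  define ratio where
    "ratio k = (real (m + k) * real (m + k + 1) - \<mu>) / (2 * real (k + 1) * real (m + k + 1)) * t" for k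
  have "ratio \<longlonglongrightarrow> 1 / 2 * t"
    unfolding ratio_def by (intro tendsto_mult tendsto_const) real_asymp
  then have "(\<lambda>k. norm (ratio k)) \<longlonglongrightarrow> norm (1 / 2 * t)"
    by (rule tendsto_norm)
  moreover have "norm (1 / 2 * t) < (1 + \<bar>t\<bar> / 2) / 2"
    using assms by (simp add: abs_mult)
  ultimately have "eventually (\<lambda>k. norm (ratio k) < (1 + \<bar>t\<bar> / 2) / 2) sequentially"
    by (rule order_tendstoD)
  then obtain N where N: "\<And>k. k \<ge> N \<Longrightarrow> norm (ratio k) < (1 + \<bar>t\<bar> / 2) / 2"
    by (auto simp: eventually_sequentially)
  show ?thesis
  proof (rule summable_ratio_test)
    show "(1 + \<bar>t\<bar> / 2) / 2 < 1"
      using assms by simp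
    fix k assume "k \<ge> N"
    have "legendre_coeff m \<mu> (Suc k) * t ^ Suc k = ratio k * (legendre_coeff m \<mu> k * t ^ k)"
      by (simp add: ratio_def)
    then show "norm (legendre_coeff m \<mu> (Suc k) * t ^ Suc k)
        \<le> (1 + \<bar>t\<bar> / 2) / 2 * norm (legendre_coeff m \<mu> k * t ^ k)"
      using less_imp_le[OF N[OF \<open>k \<ge> N\<close>]] by (simp only: norm_mult[of "ratio k"] mult_right_mono norm_ge_zero)
  qed
qed

lemma conv_radius_legendre: "ereal 2 \<le> fps_conv_radius (legendre_fps m \<mu>)"
  unfolding fps_conv_radius_def
proof (rule conv_radius_geI_ex')
  fix r :: real assume "0 < r" "ereal r < ereal 2"
  then have "\<bar>r\<bar> < 2" by simp
  then show "summable (\<lambda>n. fps_nth (legendre_fps m \<mu>) n * of_real r ^ n)"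
    using summable_legendre_coeff by (simp add: legendre_fps_def)
qed

lemma in_conv_disc:
  assumes "\<bar>t :: real\<bar> < 2"
  shows "ereal (norm t) < fps_conv_radius (legendre_fps m \<mu>)"
proof -
  have "ereal (norm t) < ereal 2" using assms by simp
  then show ?thesis using conv_radius_legendre less_le_trans by blast
qed

lemma legendre_sol_sums:
  assumes "\<bar>t\<bar> < 2"
  shows "(\<lambda>k. legendre_coeff m \<mu> k * t ^ k) sums legendre_sol m \<mu> t"
  using summable_legendre_coeff[OF assms, of m \<mu>]
  by (simp add: legendre_sol_def legendre_fps_def eval_fps_def summable_sums)

text \<open>The coefficient form of the raising relation \<open>w\<^sub>m' = - c\<^sub>m w\<^sub>m\<^sub>+\<^sub>1\<close>: every derivative of the series is
again a series of the same family.\<close>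
lemma raising_coeff:
  "real (Suc k) * legendre_coeff m \<mu> (Suc k) = - raising_const m \<mu> * legendre_coeff (Suc m) \<mu> k"
proof (induction k)
  case 0
  show ?case by (simp add: raising_const_def field_simps)
next
  case (Suc k)
  have "real (Suc (Suc k)) * legendre_coeff m \<mu> (Suc (Suc k)) =
      (real (m + Suc k) * real (m + Suc k + 1) - \<mu>) / (2 * real (k + 1) * real (m + Suc k + 1))
        * (real (Suc k) * legendre_coeff m \<mu> (Suc k))"
    by (simp add: divide_simps del: of_nat_Suc of_nat_add)
  also have "\<dots> = (real (Suc m + k) * real (Suc m + k + 1) - \<mu>) / (2 * real (k + 1) * real (Suc m + k + 1))
        * (- raising_const m \<mu> * legendre_coeff (Suc m) \<mu> k)"
    by (simp only: Suc.IH add_Suc_right add_Suc)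
  finally show ?case by (simp add: mult_ac)
qed

lemma fps_deriv_legendre:
  "fps_deriv (legendre_fps m \<mu>) = fps_const (- raising_const m \<mu>) * legendre_fps (Suc m) \<mu>"
  by (rule fps_ext) (use raising_coeff in \<open>simp add: legendre_fps_def\<close>)

lemma legendre_sol_deriv:
  assumes "\<bar>t\<bar> < 2"
  shows "(legendre_sol m \<mu> has_real_derivative - raising_const m \<mu> * legendre_sol (Suc m) \<mu> t) (at t)"
proof -
  have "(legendre_sol m \<mu> has_field_derivative eval_fps (fps_deriv (legendre_fps m \<mu>)) t) (at t)"
    unfolding legendre_sol_def
    by (rule has_field_derivative_eval_fps) (rule in_conv_disc[OF assms])
  also have "eval_fps (fps_deriv (legendre_fps m \<mu>)) t = - raising_const m \<mu> * legendre_sol (Suc m) \<mu> t"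
    unfolding fps_deriv_legendre legendre_sol_def
    using in_conv_disc[OF assms] by (subst eval_fps_mult) simp_all
  finally show ?thesis .
qed

text \<open>The coefficient form of the lowering relation, which says that \<open>(1 - x\<^sup>2)\<^sup>m\<^sup>+\<^sup>1 w\<^sub>m\<^sub>+\<^sub>1(1 - x)\<close> has the
derivative \<open>- 2(m + 1) (1 - x\<^sup>2)\<^sup>m w\<^sub>m(1 - x)\<close> with respect to \<open>x = cos \<theta>\<close>. Expressing the coefficient
for \<open>m\<close> by the one for \<open>m + 1\<close> reduces it to the recursion of a single series.\<close>
lemma lowering_coeff:
  "2 * real (k + m + 2) * legendre_coeff (Suc m) \<mu> (Suc k) - real (k + 2 * m + 2) * legendre_coeff (Suc m) \<mu> k
     = 2 * real (m + 1) * legendre_coeff m \<mu> (Suc k)"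
proof -
  let ?a = "legendre_coeff m \<mu> (Suc k)" and ?b = "legendre_coeff (Suc m) \<mu> k"
  let ?b' = "legendre_coeff (Suc m) \<mu> (Suc k)"
  have "real (k + 1) * (2 * real (k + m + 2) * ?b')
      = ((real m + real k + 1) * (real m + real k + 2) - \<mu>) * ?b"
    by (simp add: divide_simps) (simp add: algebra_simps)
  moreover have "real (k + 1) * (2 * real (m + 1) * ?a)
      = - (2 * real (m + 1) * raising_const m \<mu>) * ?b"
    using arg_cong[OF raising_coeff[of k m \<mu>], of "\<lambda>x. 2 * real (m + 1) * x"]
    by (simp add: algebra_simps del: legendre_coeff.simps)
  moreover have "2 * real (m + 1) * raising_const m \<mu> = \<mu> - real m * (real m + 1)"
    by (simp add: raising_const_def field_simps)
  ultimately have "real (k + 1) * (2 * real (k + m + 2) * ?b' - real (k + 2 * m + 2) * ?b)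
      = real (k + 1) * (2 * real (m + 1) * ?a)"
    by (simp only: right_diff_distrib) (simp add: algebra_simps del: legendre_coeff.simps)
  then show ?thesis by (simp del: legendre_coeff.simps)
qed

text \<open>The lowering relation after the derivative of \<open>w\<^sub>m\<^sub>+\<^sub>1\<close> has been replaced by means of the raising
relation. Raising and lowering together encode the second-order equation; at \<open>t = 1\<close> they relate the
equatorial data of neighbouring sectors.\<close>
lemma legendre_sol_lowering:
  assumes "\<bar>t\<bar> < 2"
  shows "t * (2 - t) * raising_const (Suc m) \<mu> * legendre_sol (Suc (Suc m)) \<mu> t
       = 2 * real (m + 1) * ((1 - t) * legendre_sol (Suc m) \<mu> t - legendre_sol m \<mu> t)"
proof -
  let ?a = "legendre_coeff m \<mu>" and ?b = "legendre_coeff (Suc m) \<mu>"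
  let ?c = "legendre_coeff (Suc (Suc m)) \<mu>" and ?r = "raising_const (Suc m) \<mu>"
  let ?u = "legendre_sol m \<mu> t" and ?v = "legendre_sol (Suc m) \<mu> t" and ?w = "legendre_sol (Suc (Suc m)) \<mu> t"
  \<comment> \<open>Multiplication by \<open>t\<close> shifts the coefficients.\<close>
  have shift: "(\<lambda>k. (case k of 0 \<Rightarrow> 0 | Suc j \<Rightarrow> f j) * t ^ k) sums (t * s)"
    if "(\<lambda>k. f k * t ^ k) sums s" for f s
  proof -
    have "(\<lambda>k. t * (f k * t ^ k)) sums (t * s)" using that by (rule sums_mult)
    then have "(\<lambda>k. (case Suc k of 0 \<Rightarrow> 0 | Suc j \<Rightarrow> f j) * t ^ Suc k) sums (t * s)"
      by (simp add: mult_ac)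
    then show ?thesis by (subst (asm) sums_Suc_iff) simp
  qed
  have a: "(\<lambda>k. ?a k * t ^ k) sums ?u" and b: "(\<lambda>k. ?b k * t ^ k) sums ?v"
    and "(\<lambda>k. ?c k * t ^ k) sums ?w"
    by (rule legendre_sol_sums[OF assms])+
  then have c: "(\<lambda>k. (?r * ?c k) * t ^ k) sums (?r * ?w)"
    using sums_mult[of _ ?w ?r] by (simp add: mult.assoc)
  have bs: "(\<lambda>k. (case k of 0 \<Rightarrow> 0 | Suc j \<Rightarrow> ?b j) * t ^ k) sums (t * ?v)"
    by (rule shift[OF b])
  have cs: "(\<lambda>k. (case k of 0 \<Rightarrow> 0 | Suc j \<Rightarrow> ?r * ?c j) * t ^ k) sums (t * (?r * ?w))"
    by (rule shift[OF c])
  have css: "(\<lambda>k. (case k of 0 \<Rightarrow> 0 | Suc l \<Rightarrow> (case l of 0 \<Rightarrow> 0 | Suc j \<Rightarrow> ?r * ?c j)) * t ^ k)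
      sums (t * (t * (?r * ?w)))"
    by (rule shift[OF cs])
  have L: "(\<lambda>k. (2 * ((case k of 0 \<Rightarrow> 0 | Suc j \<Rightarrow> ?r * ?c j) * t ^ k)
        - (case k of 0 \<Rightarrow> 0 | Suc l \<Rightarrow> (case l of 0 \<Rightarrow> 0 | Suc j \<Rightarrow> ?r * ?c j)) * t ^ k))
      sums (2 * (t * (?r * ?w)) - t * (t * (?r * ?w)))"
    by (intro sums_diff sums_mult cs css)
  have R: "(\<lambda>k. 2 * real (m + 1) * (?b k * t ^ k - (case k of 0 \<Rightarrow> 0 | Suc j \<Rightarrow> ?b j) * t ^ k - ?a k * t ^ k))
      sums (2 * real (m + 1) * (?v - t * ?v - ?u))"
    by (intro sums_diff sums_mult a b bs)
  have coeffs: "2 * (case k of 0 \<Rightarrow> 0 | Suc j \<Rightarrow> ?r * ?c j)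
        - (case k of 0 \<Rightarrow> 0 | Suc l \<Rightarrow> (case l of 0 \<Rightarrow> 0 | Suc j \<Rightarrow> ?r * ?c j))
      = 2 * real (m + 1) * (?b k - (case k of 0 \<Rightarrow> 0 | Suc j \<Rightarrow> ?b j) - ?a k)" for k
  proof (cases k)
    case 0
    then show ?thesis by simp
  next
    case (Suc j)
    have rj: "?r * ?c i = - real (Suc i) * ?b (Suc i)" for i
      by (simp only: mult_minus_left raising_coeff minus_minus)
    have "(case j of 0 \<Rightarrow> 0 | Suc i \<Rightarrow> ?r * ?c i) = - real j * ?b j"
      by (cases j) (simp_all only: rj nat.case of_nat_0 minus_zero mult_zero_left)
    then show ?thesis
      using lowering_coeff[of j m \<mu>]
      by (simp add: Suc rj del: legendre_coeff.simps) (simp add: algebra_simps del: legendre_coeff.simps)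
  qed
  have "2 * (t * (?r * ?w)) - t * (t * (?r * ?w)) = 2 * real (m + 1) * (?v - t * ?v - ?u)"
  proof (rule sums_unique2[OF L])
    have "(\<lambda>k. (2 * ((case k of 0 \<Rightarrow> 0 | Suc j \<Rightarrow> ?r * ?c j) * t ^ k)
        - (case k of 0 \<Rightarrow> 0 | Suc l \<Rightarrow> (case l of 0 \<Rightarrow> 0 | Suc j \<Rightarrow> ?r * ?c j)) * t ^ k))
      = (\<lambda>k. 2 * real (m + 1) * (?b k * t ^ k - (case k of 0 \<Rightarrow> 0 | Suc j \<Rightarrow> ?b j) * t ^ k - ?a k * t ^ k))"
    proof
      fix k
      show "2 * ((case k of 0 \<Rightarrow> 0 | Suc j \<Rightarrow> ?r * ?c j) * t ^ k)
          - (case k of 0 \<Rightarrow> 0 | Suc l \<Rightarrow> (case l of 0 \<Rightarrow> 0 | Suc j \<Rightarrow> ?r * ?c j)) * t ^ k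
        = 2 * real (m + 1) * (?b k * t ^ k - (case k of 0 \<Rightarrow> 0 | Suc j \<Rightarrow> ?b j) * t ^ k - ?a k * t ^ k)"
        using arg_cong[OF coeffs[of k], of "\<lambda>x. x * t ^ k"] by (simp only: algebra_simps)
    qed
    then show "(\<lambda>k. (2 * ((case k of 0 \<Rightarrow> 0 | Suc j \<Rightarrow> ?r * ?c j) * t ^ k)
        - (case k of 0 \<Rightarrow> 0 | Suc l \<Rightarrow> (case l of 0 \<Rightarrow> 0 | Suc j \<Rightarrow> ?r * ?c j)) * t ^ k))
      sums (2 * real (m + 1) * (?v - t * ?v - ?u))"
      using R by simp
  qed
  then show ?thesis by (simp add: algebra_simps)
qed

section \<open>Value and slope at the equator\<close>

definition equator_value :: "nat \<Rightarrow> real \<Rightarrow> real" where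
  "equator_value m \<mu> = legendre_sol m \<mu> 1"

text \<open>The derivative with respect to \<open>cos \<theta>\<close> at the equator, that is, minus the outward normal derivative.\<close>
definition equator_slope :: "nat \<Rightarrow> real \<Rightarrow> real" where
  "equator_slope m \<mu> = raising_const m \<mu> * equator_value (Suc m) \<mu>"

text \<open>The Robin condition for the regular solution. Its factor \<open>sin\<^sup>m \<theta>\<close> has value \<open>1\<close> and derivative \<open>0\<close> at the
equator, so the condition concerns the power series alone.\<close>
definition robin_root :: "real \<Rightarrow> nat \<Rightarrow> real \<Rightarrow> bool" where
  "robin_root \<sigma> m \<mu> \<longleftrightarrow> equator_slope m \<mu> = \<sigma> * equator_value m \<mu>"

lemma equator_slope_Suc: "equator_slope (Suc m) \<mu> = - 2 * real (m + 1) * equator_value m \<mu>"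
  using legendre_sol_lowering[of 1 m \<mu>] by (simp add: equator_slope_def equator_value_def algebra_simps)

lemma two_raising_const: "2 * real (m + 1) * raising_const m \<mu> = \<mu> - real m * (real m + 1)"
  by (simp add: raising_const_def field_simps)

text \<open>The two first-order ladder relations at the equator, multiplied. This form contains no division and
turns into a two-term recursion for the quotients slope over value.\<close>
lemma equator_product:
  "equator_slope m \<mu> * equator_slope (Suc m) \<mu>
     = (real m * (real m + 1) - \<mu>) * (equator_value m \<mu> * equator_value (Suc m) \<mu>)"
proof -
  have "equator_slope m \<mu> * equator_slope (Suc m) \<mu>
      = - (2 * real (m + 1) * raising_const m \<mu>) * (equator_value m \<mu> * equator_value (Suc m) \<mu>)"
    unfolding equator_slope_Suc by (simp add: equator_slope_def algebra_simps)
  then show ?thesis unfolding two_raising_const by simp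
qed

lemma equator_value_sums: "legendre_coeff m \<mu> sums equator_value m \<mu>"
  using legendre_sol_sums[of 1 m \<mu>] by (simp add: equator_value_def)

text \<open>Below the lowest level \<open>m(m + 1)\<close> of the sector no factor of the recursion is negative. This excludes
roots there and provides the starting point of the downward inductions on \<open>m\<close>.\<close>
lemma legendre_coeff_nonneg:
  assumes "\<mu> \<le> real m * (real m + 1)"
  shows "legendre_coeff m \<mu> k \<ge> 0"
proof (induction k)
  case (Suc k)
  have "real m * (real m + 1) \<le> real (m + k) * real (m + k + 1)"
    by (intro mult_mono) auto
  with assms Suc show ?case by (auto intro!: mult_nonneg_nonneg divide_nonneg_nonneg)
qed simp

lemma equator_value_ge_1:
  assumes "\<mu> \<le> real m * (real m + 1)"
  shows "equator_value m \<mu> \<ge> 1"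
proof -
  have "sum (legendre_coeff m \<mu>) {0} \<le> suminf (legendre_coeff m \<mu>)"
    by (rule sum_le_suminf)
      (use assms equator_value_sums in \<open>auto simp: legendre_coeff_nonneg sums_iff\<close>)
  then show ?thesis using equator_value_sums[of m \<mu>] by (simp add: sums_iff)
qed

lemma level_le: "m \<le> n \<Longrightarrow> real m * (real m + 1) \<le> real n * (real n + 1)"
  by (intro mult_mono) auto

lemma level_less: "m < n \<Longrightarrow> real m * (real m + 1) < real n * (real n + 1)"
  by (intro mult_strict_mono) auto

lemma equator_slope_nonpos:
  assumes "\<mu> \<le> real m * (real m + 1)"
  shows "equator_slope m \<mu> \<le> 0"
proof -
  have "equator_value (Suc m) \<mu> \<ge> 1"
    by (rule equator_value_ge_1) (use assms level_le[of m "Suc m"] in linarith)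
  then show ?thesis
    using assms unfolding equator_slope_def raising_const_def
    by (intro mult_nonpos_nonneg divide_nonpos_pos) auto
qed

text \<open>At a level \<open>l(l + 1)\<close> the solution is an even or odd polynomial in \<open>cos \<theta>\<close>, so exactly one of the two
data vanishes, and the Robin condition with \<open>\<sigma> > 0\<close> fails. The induction descends from \<open>m = l\<close>, where
the solution is constant; the ladder relations exchange value and slope.\<close>
lemma equator_data_at_level:
  assumes "m \<le> l"
  shows "(equator_value m (real l * (real l + 1)) = 0) \<noteq> (equator_slope m (real l * (real l + 1)) = 0)"
  using assms
proof (induction m rule: inc_induct)
  case base
  show ?case
    using equator_value_ge_1[of "real l * (real l + 1)" l]
    by (simp add: equator_slope_def raising_const_def)
next
  case (step m)
  have "raising_const m (real l * (real l + 1)) \<noteq> 0"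
    using level_less[OF \<open>m < l\<close>] by (simp add: raising_const_def add_eq_0_iff)
  with step.IH show ?case
    by (simp add: equator_slope_Suc) (simp add: equator_slope_def)
qed

text \<open>For large \<open>m\<close> both data are nonzero by positivity, and away from the levels the ladder factors never
vanish, so this descends to every \<open>m\<close>.\<close>
lemma equator_data_off_levels:
  assumes "\<And>l. m \<le> l \<Longrightarrow> \<mu> \<noteq> real l * (real l + 1)"
  shows "equator_value m \<mu> \<noteq> 0 \<and> equator_slope m \<mu> \<noteq> 0"
proof -
  obtain M where "\<mu> < real M" using reals_Archimedean2 by blast
  also have "real M \<le> real (max m M) * (real (max m M) + 1)"
    using mult_mono[of "real M" "real (max m M)" 1 "real (max m M) + 1"] by auto
  finally have large: "\<mu> < real (max m M) * (real (max m M) + 1)" .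
  have "m \<le> max m M" by simp
  then show ?thesis
    using assms
  proof (induction m rule: inc_induct)
    case base
    have "equator_value (max m M) \<mu> \<ge> 1" "equator_value (Suc (max m M)) \<mu> \<ge> 1"
      using large level_le[of "max m M" "Suc (max m M)"]
      by (intro equator_value_ge_1; linarith)+
    moreover have "raising_const (max m M) \<mu> \<noteq> 0"
      using large by (simp add: raising_const_def add_eq_0_iff)
    ultimately show ?case by (auto simp: equator_slope_def)
  next
    case (step n)
    have "raising_const n \<mu> \<noteq> 0"
      using step.prems[of n] by (simp add: raising_const_def add_eq_0_iff)
    moreover have "equator_value (Suc n) \<mu> \<noteq> 0 \<and> equator_slope (Suc n) \<mu> \<noteq> 0"
      using step.IH step.prems Suc_leD by blast
    ultimately show ?case
      by (simp add: equator_slope_Suc) (simp add: equator_slope_def)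
  qed
qed

text \<open>For \<open>\<mu> = 0\<close> the series is \<open>(1 - t/2)\<^sup>-\<^sup>m\<close>.\<close>
lemma legendre_coeff_0_sums: "legendre_coeff m 0 sums 2 ^ m"
proof -
  have "legendre_coeff m 0 = (\<lambda>k. (- real m gchoose k) * (- 1 / 2) ^ k)"
  proof
    fix k show "legendre_coeff m 0 k = (- real m gchoose k) * (- 1 / 2) ^ k"
    proof (induction k)
    case (Suc k)
    have g: "(- real m gchoose Suc k) = - (real m + real k) / (real k + 1) * (- real m gchoose k)"
      by (simp add: gbinomial_pochhammer pochhammer_Suc divide_simps) (simp add: algebra_simps)
    have "legendre_coeff m 0 (Suc k) = (real m + real k) / (2 * (real k + 1)) * legendre_coeff m 0 k"
      by (simp add: divide_simps)
    also note Suc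
    finally show ?case
      unfolding g by (simp add: field_simps del: legendre_coeff.simps)
    qed simp
  qed
  moreover have "(\<lambda>k. (- real m gchoose k) * (- 1 / 2) ^ k) sums (1 + (- 1 / 2)) powr (- real m)"
    by (rule gen_binomial_real) simp
  moreover have "(1 + (- 1 / 2)) powr (- real m) = 2 ^ m"
    by (simp add: powr_minus powr_realpow power_divide)
  ultimately show ?thesis by simp
qed

text \<open>The quotient of the coefficients for \<open>\<mu>\<close> and for \<open>0\<close> is the product of
\<open>1 - \<mu> / ((m + j)(m + j + 1))\<close> over \<open>j < k\<close>. A product of numbers in \<open>[0, 1]\<close> is at least one minus
the sum of the defects, and this sum telescopes to at most \<open>\<mu> / m\<close>.\<close>
lemma legendre_coeff_compare:
  assumes "0 \<le> \<mu>" "\<mu> \<le> real m * (real m + 1)" "0 < m"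
  shows "legendre_coeff m \<mu> k \<le> legendre_coeff m 0 k"
    and "(1 - \<mu> / real m) * legendre_coeff m 0 k \<le> legendre_coeff m \<mu> k"
proof -
  have pos0: "legendre_coeff m 0 k \<ge> 0" for k
    by (rule legendre_coeff_nonneg) simp
  have pos: "legendre_coeff m \<mu> k \<ge> 0" for k
    by (rule legendre_coeff_nonneg) (rule assms)
  show le: "legendre_coeff m \<mu> k \<le> legendre_coeff m 0 k" for k
  proof (induction k)
    case (Suc k)
    have "real m * (real m + 1) \<le> real (m + k) * real (m + k + 1)"
      by (intro mult_mono) auto
    with assms Suc pos show ?case
      unfolding legendre_coeff.simps
      by (intro mult_mono divide_right_mono) (auto intro!: divide_nonneg_nonneg)
  qed simp
  have "(1 - \<mu> * (1 / real m - 1 / real (m + k))) * legendre_coeff m 0 k \<le> legendre_coeff m \<mu> k"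
  proof (induction k)
    case (Suc k)
    define R where "R = real (m + k) * real (m + k + 1)"
    define d where "d = 1 / real m - 1 / real (m + k)"
    define C where "C = 2 * real (k + 1) * real (m + k + 1)"
    have R: "R > 0" "\<mu> \<le> R" and C: "C > 0"
      using assms(3) order_trans[OF assms(2), of R] mult_mono[of "real m" "real (m + k)" "real m + 1" "real (m + k + 1)"]
      by (auto simp: R_def C_def)
    have tele: "1 / real m - 1 / real (m + Suc k) = d + 1 / R"
      using assms(3) by (simp add: R_def d_def divide_simps) (simp add: algebra_simps)
    have "0 \<le> d"
      using assms(3) by (simp add: d_def divide_simps)
    then have "0 \<le> \<mu> * d * (\<mu> / R)"
      using assms(1) R by simp
    then have step: "1 - \<mu> * (1 / real m - 1 / real (m + Suc k))
        \<le> (1 - \<mu> / R) * (1 - \<mu> * (1 / real m - 1 / real (m + k)))"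
      unfolding tele d_def[symmetric] by (simp add: algebra_simps)
    have "(1 - \<mu> * (1 / real m - 1 / real (m + Suc k))) * legendre_coeff m 0 (Suc k)
        \<le> (1 - \<mu> / R) * (1 - \<mu> * (1 / real m - 1 / real (m + k))) * legendre_coeff m 0 (Suc k)"
      by (rule mult_right_mono[OF step pos0])
    also have "\<dots> = (R - \<mu>) / C * ((1 - \<mu> * (1 / real m - 1 / real (m + k))) * legendre_coeff m 0 k)"
    proof -
      have "legendre_coeff m 0 (Suc k) = R / C * legendre_coeff m 0 k"
        by (simp add: R_def C_def)
      moreover have "(R - \<mu>) / C = (1 - \<mu> / R) * (R / C)"
        using R C by (simp add: field_simps)
      ultimately show ?thesis by (simp only: mult_ac)
    qed
    also have "\<dots> \<le> (R - \<mu>) / C * legendre_coeff m \<mu> k"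
      using R C by (intro mult_left_mono Suc.IH) auto
    also have "\<dots> = legendre_coeff m \<mu> (Suc k)"
      by (simp add: R_def C_def)
    finally show ?case .
  qed simp
  moreover have "1 - \<mu> / real m \<le> 1 - \<mu> * (1 / real m - 1 / real (m + k))"
    using assms(1) by (simp add: algebra_simps)
  ultimately show "(1 - \<mu> / real m) * legendre_coeff m 0 k \<le> legendre_coeff m \<mu> k"
    using mult_right_mono[OF _ pos0[of k]] order_trans by blast
qed

lemma equator_value_bounds:
  assumes "0 \<le> \<mu>" "\<mu> \<le> real m * (real m + 1)" "0 < m"
  shows "equator_value m \<mu> \<le> 2 ^ m" "(1 - \<mu> / real m) * 2 ^ m \<le> equator_value m \<mu>"
  using legendre_coeff_compare[OF assms]
  by (auto intro: sums_le[OF _ equator_value_sums legendre_coeff_0_sums]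
      sums_le[OF _ sums_mult[OF legendre_coeff_0_sums] equator_value_sums])

lemma normalized_equator_value_tendsto:
  assumes "0 \<le> \<mu>"
  shows "(\<lambda>m. equator_value m \<mu> / 2 ^ m) \<longlonglongrightarrow> 1"
proof (rule tendsto_sandwich)
  obtain M where M: "\<mu> < real M" using reals_Archimedean2 by blast
  have big: "\<mu> \<le> real m * (real m + 1) \<and> 0 < m" if "m \<ge> Suc M" for m
    using mult_mono[of "real M" "real m" 1 "real m + 1"] M that by auto
  then have ev: "eventually (\<lambda>m. \<mu> \<le> real m * (real m + 1) \<and> 0 < m) sequentially"
    unfolding eventually_sequentially using big by blast
  show "\<forall>\<^sub>F m in sequentially. 1 - \<mu> / real m \<le> equator_value m \<mu> / 2 ^ m"
    using ev by eventually_elim (use equator_value_bounds(2)[OF assms] in \<open>simp add: field_simps\<close>)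
  show "\<forall>\<^sub>F m in sequentially. equator_value m \<mu> / 2 ^ m \<le> 1"
    using ev by eventually_elim (use equator_value_bounds(1)[OF assms] in \<open>simp add: field_simps\<close>)
  show "(\<lambda>m. 1 - \<mu> / real m) \<longlonglongrightarrow> 1"
    by real_asymp
qed simp

text \<open>The normalization that singles out one solution of the two-term recursion for the quotients.\<close>
lemma equator_ratio_asymp:
  assumes "0 \<le> \<mu>"
  shows "(\<lambda>m. equator_slope m \<mu> / equator_value m \<mu> / real m) \<longlonglongrightarrow> -1"
proof -
  have "(\<lambda>m. (equator_value (Suc m) \<mu> / 2 ^ Suc m) / (equator_value m \<mu> / 2 ^ m)
      * (2 * raising_const m \<mu> / real m)) \<longlonglongrightarrow> 1 / 1 * -1"
  proof (intro tendsto_mult tendsto_divide normalized_equator_value_tendsto assms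
      LIMSEQ_Suc[OF normalized_equator_value_tendsto])
    show "(\<lambda>m. 2 * raising_const m \<mu> / real m) \<longlonglongrightarrow> -1"
      unfolding raising_const_def by real_asymp
  qed simp
  then show ?thesis
    by (simp add: equator_slope_def mult_ac)
qed

section \<open>Ratios of Gamma values\<close>

lemma pos_notin_nonpos_Ints: "0 < x \<Longrightarrow> x \<notin> \<int>\<^sub>\<le>\<^sub>0" for x :: real
  by (auto elim!: nonpos_Ints_cases)

definition gamma_ratio :: "real \<Rightarrow> real" where
  "gamma_ratio x = Gamma (x + 1 / 2) / Gamma x"

lemma gamma_ratio_pos: "x > 0 \<Longrightarrow> gamma_ratio x > 0"
  by (simp add: gamma_ratio_def)

lemma gamma_ratio_mult:
  assumes "x \<notin> \<int>\<^sub>\<le>\<^sub>0" "x + 1 / 2 \<notin> \<int>\<^sub>\<le>\<^sub>0"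
  shows "gamma_ratio x * gamma_ratio (x + 1 / 2) = x"
  using assms Gamma_plus1[OF assms(1)]
  by (simp add: gamma_ratio_def Gamma_eq_zero_iff add.commute[of x 1])

lemma gamma_ratio_exp: "x > 0 \<Longrightarrow> gamma_ratio x = exp (ln_Gamma (x + 1 / 2) - ln_Gamma x)"
  by (simp add: gamma_ratio_def exp_diff Gamma_real_pos_exp)

text \<open>Log-convexity of the Gamma function, in the form that the Digamma function increases.\<close>
lemma gamma_ratio_mono:
  assumes "0 < x" "x \<le> y"
  shows "gamma_ratio x \<le> gamma_ratio y"
proof -
  have "(\<lambda>z. ln_Gamma (z + 1 / 2) - ln_Gamma z) x \<le> (\<lambda>z. ln_Gamma (z + 1 / 2) - ln_Gamma z) y"
  proof (rule DERIV_nonneg_imp_nondecreasing[OF assms(2)])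
    fix z assume z: "x \<le> z" "z \<le> y"
    then have "z > 0" using assms by simp
    then have "((\<lambda>z. ln_Gamma (z + 1 / 2) - ln_Gamma z) has_real_derivative Digamma (z + 1 / 2) - Digamma z) (at z)"
      by (auto intro!: derivative_eq_intros)
    moreover have "0 \<le> Digamma (z + 1 / 2) - Digamma z"
      using \<open>z > 0\<close> Polygamma_real_mono[of z "z + 1 / 2" 0] by simp
    ultimately show "\<exists>D. ((\<lambda>z. ln_Gamma (z + 1 / 2) - ln_Gamma z) has_real_derivative D) (at z) \<and> 0 \<le> D"
      by blast
  qed
  then show ?thesis using assms by (simp add: gamma_ratio_exp)
qed

text \<open>The values at \<open>x\<close> and \<open>x + 1/2\<close> have the product \<open>x\<close>, and the second one is at least as large as
the first.\<close>
lemma gamma_ratio_le_sqrt: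
  assumes "x > 0"
  shows "gamma_ratio x \<le> sqrt x"
proof (rule real_le_rsqrt)
  have "(gamma_ratio x)\<^sup>2 \<le> gamma_ratio x * gamma_ratio (x + 1 / 2)"
    unfolding power2_eq_square
    using assms gamma_ratio_mono[of x "x + 1 / 2"] gamma_ratio_pos[of x]
    by (intro mult_left_mono) auto
  also have "\<dots> = x"
    by (rule gamma_ratio_mult) (use assms in \<open>auto intro!: pos_notin_nonpos_Ints\<close>)
  finally show "(gamma_ratio x)\<^sup>2 \<le> x" .
qed

lemma gamma_ratio_ge:
  assumes "x > 0"
  shows "x / sqrt (x + 1 / 2) \<le> gamma_ratio x"
proof -
  have "x = gamma_ratio x * gamma_ratio (x + 1 / 2)"
    by (rule gamma_ratio_mult[symmetric]) (use assms in \<open>auto intro!: pos_notin_nonpos_Ints\<close>)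
  also have "\<dots> \<le> gamma_ratio x * sqrt (x + 1 / 2)"
    using assms gamma_ratio_pos[of x] gamma_ratio_le_sqrt[of "x + 1 / 2"]
    by (intro mult_left_mono) auto
  finally show ?thesis using assms by (simp add: field_simps)
qed

lemma gamma_ratio_asymp: "((\<lambda>x. gamma_ratio x / sqrt x) \<longlongrightarrow> 1) at_top"
proof (rule tendsto_sandwich)
  show "\<forall>\<^sub>F x in at_top. x / sqrt (x + 1 / 2) / sqrt x \<le> gamma_ratio x / sqrt x"
    using eventually_gt_at_top[of 0]
    by eventually_elim (intro divide_right_mono gamma_ratio_ge, auto)
  show "\<forall>\<^sub>F x in at_top. gamma_ratio x / sqrt x \<le> 1"
    using eventually_gt_at_top[of 0]
    by eventually_elim (use gamma_ratio_le_sqrt in simp)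
  show "((\<lambda>x::real. x / sqrt (x + 1 / 2) / sqrt x) \<longlongrightarrow> 1) at_top"
    by real_asymp
qed simp

lemma continuous_on_gamma_ratio: "continuous_on {0<..} gamma_ratio"
  unfolding gamma_ratio_def
  by (intro continuous_on_divide continuous_on_compose2[OF continuous_on_Gamma[of "{0<..}"]] continuous_on_Gamma
      continuous_intros) (auto simp: Gamma_eq_zero_iff elim!: nonpos_Ints_cases)

text \<open>Euler's reflection formula for numerator and denominator separately: one gives a sine and the other
a cosine, hence the tangent.\<close>
lemma gamma_ratio_reflection:
  assumes "2 * y \<notin> \<int>"
  shows "gamma_ratio (- y) = - tan (pi * y) * gamma_ratio (y + 1 / 2)"
proof -
  have refl: "Gamma z * Gamma (1 - z) = pi / sin (pi * z)" for z :: real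
  proof -
    have "complex_of_real (Gamma z * Gamma (1 - z)) = complex_of_real (pi / sin (pi * z))"
      using Gamma_reflection_complex[of "complex_of_real z"]
      by (simp flip: Gamma_complex_of_real sin_of_real)
    then show ?thesis by (simp only: of_real_eq_iff)
  qed
  have half: "z \<notin> \<int>\<^sub>\<le>\<^sub>0" if "2 * z \<notin> \<int>" for z :: real
    using that by (auto elim!: nonpos_Ints_cases)
  have notint: "2 * (- y) \<notin> \<int>" "2 * (y + 1) \<notin> \<int>" "2 * (y + 1 / 2) \<notin> \<int>" "2 * (1 / 2 - y) \<notin> \<int>"
    using assms Ints_minus[of "- (2 * y)"] Ints_diff[of "2 * y + 2" 2] Ints_diff[of "2 * y + 1" 1]
      Ints_diff[of 1 "1 - 2 * y"] by (auto simp: algebra_simps)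
  note nz = half[OF notint(1)] half[OF notint(2)] half[OF notint(3)] half[OF notint(4)]
  have sin: "sin (pi * y) \<noteq> 0" and cos: "cos (pi * y) \<noteq> 0"
  proof -
    have "sin (2 * (pi * y)) \<noteq> 0"
      using assms by (auto simp: sin_zero_iff_int2 mult_ac)
    then show "sin (pi * y) \<noteq> 0" "cos (pi * y) \<noteq> 0" by (auto simp: sin_double)
  qed
  have G1: "Gamma (- y) * Gamma (y + 1) = - pi / sin (pi * y)"
    using refl[of "- y"] by (simp add: add.commute)
  have G2: "Gamma (1 / 2 - y) * Gamma (y + 1 / 2) = pi / cos (pi * y)"
  proof -
    have "sin (pi * (1 / 2 - y)) = cos (pi * y)"
      by (simp add: cos_sin_eq algebra_simps)
    then show ?thesis using refl[of "1 / 2 - y"] by (simp add: algebra_simps)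
  qed
  have divide: "b / a = - (s / c) * (a' / b')"
    if "a * a' = - pi / s" "b * b' = pi / c" "a \<noteq> 0" "b' \<noteq> 0" "s \<noteq> 0" "c \<noteq> 0"
    for a a' b b' s c :: real
    using that by (simp add: field_simps)
  have "Gamma (- y) \<noteq> 0" "Gamma (y + 1 / 2) \<noteq> 0"
    using nz by (simp_all only: Gamma_eq_zero_iff not_False_eq_True)
  from divide[OF G1 G2 this sin cos] show ?thesis
    by (simp add: gamma_ratio_def tan_def add.commute)
qed

section \<open>Location of the Robin roots\<close>

text \<open>The relation makes the sequence periodic with period two, and a periodic sequence with a limit is constant.\<close>
lemma period_two_constant:
  fixes r :: "nat \<Rightarrow> real"
  assumes "\<And>m. r m * r (Suc m) = 1" and "r \<longlonglongrightarrow> 1"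
  shows "r m = 1"
proof -
  have step: "r (m + 2) = r m" for m
    using assms(1)[of m] assms(1)[of "Suc m"]
    by (metis add_2_eq_Suc' mult.commute mult.left_neutral mult.left_commute mult_1_right)
  have "r (2 * j + m) = r m" for j
    by (induction j) (use step in \<open>simp_all add: algebra_simps\<close>)
  moreover have "(\<lambda>j. r (2 * j + m)) \<longlonglongrightarrow> 1"
    by (rule LIMSEQ_subseq_LIMSEQ[OF assms(2), of "\<lambda>j. 2 * j + m", unfolded o_def])
      (auto simp: strict_mono_def)
  ultimately show ?thesis by (simp add: LIMSEQ_const_iff)
qed

text \<open>Both sides satisfy the recursion \<open>q\<^sub>m q\<^sub>m\<^sub>+\<^sub>1 = (m + \<nu> + 1)(m - \<nu>)\<close> and are asymptotic to \<open>- m\<close>.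
Consecutive values of their quotient therefore multiply to \<open>1\<close> while the quotient tends to \<open>1\<close>.\<close>
lemma equator_ratio_eq:
  assumes "\<nu> > 0" "\<nu> \<notin> \<int>"
  shows "equator_slope m (\<nu> * (\<nu> + 1)) / equator_value m (\<nu> * (\<nu> + 1))
      = - 2 * gamma_ratio ((real m + \<nu> + 1) / 2) * gamma_ratio ((real m - \<nu>) / 2)"
proof -
  define \<mu> where "\<mu> = \<nu> * (\<nu> + 1)"
  define q where "q m = equator_slope m \<mu> / equator_value m \<mu>" for m
  define Q where "Q m = - 2 * gamma_ratio ((real m + \<nu> + 1) / 2) * gamma_ratio ((real m - \<nu>) / 2)" for m
  have factor: "real l * (real l + 1) - \<mu> = (real l + \<nu> + 1) * (real l - \<nu>)" for l
    by (simp add: \<mu>_def algebra_simps)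
  have "real l - \<nu> \<noteq> 0" for l
    using assms(2) by auto
  then have "real l * (real l + 1) - \<mu> \<noteq> 0" for l
    using assms(1) unfolding factor by (simp add: add_nonneg_eq_0_iff add_pos_nonneg)
  then have nonres: "\<mu> \<noteq> real l * (real l + 1)" for l
    by (metis diff_self)
  have nz: "equator_value m \<mu> \<noteq> 0" "equator_slope m \<mu> \<noteq> 0" for m
    using equator_data_off_levels[of m \<mu>] nonres by auto
  have q: "q m * q (Suc m) = (real m + \<nu> + 1) * (real m - \<nu>)" for m
    using equator_product[of m \<mu>] nz[of m] nz[of "Suc m"] unfolding q_def factor
    by (simp add: field_simps)
  have Q: "Q m * Q (Suc m) = (real m + \<nu> + 1) * (real m - \<nu>)" for m
  proof -
    have a: "gamma_ratio ((real m + \<nu> + 1) / 2) * gamma_ratio ((real m + \<nu> + 1) / 2 + 1 / 2) = (real m + \<nu> + 1) / 2"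
      by (intro gamma_ratio_mult pos_notin_nonpos_Ints) (use assms(1) in \<open>auto intro!: add_nonneg_pos\<close>)
    have "2 * x \<notin> \<int> \<Longrightarrow> x \<notin> \<int>\<^sub>\<le>\<^sub>0" for x :: real
      by (auto elim!: nonpos_Ints_cases)
    moreover have "2 * ((real m - \<nu>) / 2) \<notin> \<int>" "2 * ((real m - \<nu>) / 2 + 1 / 2) \<notin> \<int>"
    proof -
      have "real m - \<nu> \<notin> \<int>" "real m - \<nu> + 1 \<notin> \<int>"
        using assms(2) Ints_diff[of "real m" "real m - \<nu>"] Ints_diff[of "real m + 1" "real m - \<nu> + 1"] by auto
      moreover have "2 * ((real m - \<nu>) / 2) = real m - \<nu>" "2 * ((real m - \<nu>) / 2 + 1 / 2) = real m - \<nu> + 1"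
        by (simp_all add: field_simps)
      ultimately show "2 * ((real m - \<nu>) / 2) \<notin> \<int>" "2 * ((real m - \<nu>) / 2 + 1 / 2) \<notin> \<int>"
        by metis+
    qed
    ultimately have b: "gamma_ratio ((real m - \<nu>) / 2) * gamma_ratio ((real m - \<nu>) / 2 + 1 / 2) = (real m - \<nu>) / 2"
      by (intro gamma_ratio_mult) blast+
    have "Q m * Q (Suc m) = 4 * (gamma_ratio ((real m + \<nu> + 1) / 2) * gamma_ratio ((real m + \<nu> + 1) / 2 + 1 / 2))
        * (gamma_ratio ((real m - \<nu>) / 2) * gamma_ratio ((real m - \<nu>) / 2 + 1 / 2))"
    proof -
      have "(real (Suc m) + \<nu> + 1) / 2 = (real m + \<nu> + 1) / 2 + 1 / 2"
        "(real (Suc m) - \<nu>) / 2 = (real m - \<nu>) / 2 + 1 / 2"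
        by (simp_all add: field_simps)
      then show ?thesis by (simp only: Q_def) simp
    qed
    also have "\<dots> = (real m + \<nu> + 1) * (real m - \<nu>)"
      unfolding a b by simp
    finally show ?thesis .
  qed
  have qQ: "q m * q (Suc m) \<noteq> 0" "Q m * Q (Suc m) \<noteq> 0" for m
    unfolding q Q using nonres[of m] factor[of m] by auto
  have "q m / Q m = 1"
  proof (rule period_two_constant[of "\<lambda>m. q m / Q m"])
    show "q m / Q m * (q (Suc m) / Q (Suc m)) = 1" for m
      using q[of m] Q[of m] qQ[of m] by simp
    have "\<mu> \<ge> 0" using assms(1) by (simp add: \<mu>_def)
    then have q1: "(\<lambda>m. q m / real m) \<longlonglongrightarrow> -1"
      unfolding q_def by (rule equator_ratio_asymp)
    have s: "(\<lambda>m. sqrt ((real m + \<nu> + 1) / 2) * sqrt ((real m - \<nu>) / 2) * 2 / real m) \<longlonglongrightarrow> 1"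
      by real_asymp (simp flip: powr_add)
    have "filterlim (\<lambda>m. (real m + \<nu> + 1) / 2) at_top sequentially"
      "filterlim (\<lambda>m. (real m - \<nu>) / 2) at_top sequentially"
      by real_asymp+
    then have "(\<lambda>m. - ((gamma_ratio ((real m + \<nu> + 1) / 2) / sqrt ((real m + \<nu> + 1) / 2))
        * (gamma_ratio ((real m - \<nu>) / 2) / sqrt ((real m - \<nu>) / 2))
        * (sqrt ((real m + \<nu> + 1) / 2) * sqrt ((real m - \<nu>) / 2) * 2 / real m)))
      \<longlonglongrightarrow> - (1 * 1 * 1)"
      by (intro tendsto_minus tendsto_mult s filterlim_compose[OF gamma_ratio_asymp])
    moreover have "\<forall>\<^sub>F m in sequentially. - ((gamma_ratio ((real m + \<nu> + 1) / 2) / sqrt ((real m + \<nu> + 1) / 2))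
        * (gamma_ratio ((real m - \<nu>) / 2) / sqrt ((real m - \<nu>) / 2))
        * (sqrt ((real m + \<nu> + 1) / 2) * sqrt ((real m - \<nu>) / 2) * 2 / real m)) = Q m / real m"
    proof -
      have "\<forall>\<^sub>F m in sequentially. real m > \<nu>" by real_asymp
      then show ?thesis
      proof eventually_elim
        case (elim m)
        have "sqrt ((real m + \<nu> + 1) / 2) > 0" "sqrt ((real m - \<nu>) / 2) > 0"
          using elim assms(1) by auto
        then show ?case by (simp add: Q_def field_simps)
      qed
    qed
    ultimately have "(\<lambda>m. Q m / real m) \<longlonglongrightarrow> - (1 * 1 * 1)"
      by (rule Lim_transform_eventually)
    then have Q1: "(\<lambda>m. Q m / real m) \<longlonglongrightarrow> -1" by simp
    have "(\<lambda>m. (q m / real m) / (Q m / real m)) \<longlonglongrightarrow> -1 / -1"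
      by (intro tendsto_divide q1 Q1) simp
    moreover have "\<forall>\<^sub>F m in sequentially. (q m / real m) / (Q m / real m) = q m / Q m"
      using eventually_gt_at_top[of 0] by eventually_elim simp
    ultimately have "(\<lambda>m. q m / Q m) \<longlonglongrightarrow> -1 / -1"
      by (rule Lim_transform_eventually)
    then show "(\<lambda>m. q m / Q m) \<longlonglongrightarrow> 1" by simp
  qed
  moreover have "Q m \<noteq> 0" using qQ(2)[of m] by auto
  ultimately have "q m = Q m" by simp
  then show ?thesis unfolding q_def Q_def \<mu>_def .
qed

text \<open>Slope over value at \<open>\<nu> = l + s\<close>, for \<open>l \<ge> m\<close> of the parity of \<open>m\<close> and \<open>0 < s < 1\<close>.\<close>
definition robin_ratio :: "nat \<Rightarrow> nat \<Rightarrow> real \<Rightarrow> real" where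
  "robin_ratio m l s = 2 * gamma_ratio ((real l + s + real m + 1) / 2)
      * gamma_ratio ((real l + s - real m + 1) / 2) * tan (pi / 2 * s)"

lemma tan_parity:
  assumes "m \<le> l"
  shows "even (l + m) \<Longrightarrow> tan (pi * ((real l + s - real m) / 2)) = tan (pi / 2 * s)"
    and "odd (l + m) \<Longrightarrow> tan (pi * ((real l + s - real m) / 2)) = tan (pi / 2 * (s + 1))"
proof -
  have per: "tan (x + real k * pi) = tan x" for x k
    by (rule tan_periodic_nat)
  obtain d where d: "l = m + d" using assms le_Suc_ex by blast
  show "even (l + m) \<Longrightarrow> tan (pi * ((real l + s - real m) / 2)) = tan (pi / 2 * s)"
  proof -
    assume "even (l + m)"
    then obtain k where "d = 2 * k" using d by (auto elim!: evenE)
    then have "pi * ((real l + s - real m) / 2) = pi / 2 * s + real k * pi"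
      by (simp add: d field_simps)
    then show ?thesis by (simp only: per)
  qed
  show "odd (l + m) \<Longrightarrow> tan (pi * ((real l + s - real m) / 2)) = tan (pi / 2 * (s + 1))"
  proof -
    assume "odd (l + m)"
    then have "odd d" using d by auto
    then obtain k where "d = 2 * k + 1" by (auto elim!: oddE)
    then have "pi * ((real l + s - real m) / 2) = pi / 2 * (s + 1) + real k * pi"
      by (simp add: d field_simps)
    then show ?thesis by (simp only: per)
  qed
qed

text \<open>For \<open>m < \<nu>\<close> the second argument in \<open>equator_ratio_eq\<close> is negative; reflection moves it to the
positive axis, where monotonicity and the square-root bounds apply.\<close>
lemma equator_ratio_tan:
  assumes "m \<le> l" "0 < s" "s < 1"
  shows "equator_slope m ((real l + s) * (real l + s + 1)) / equator_value m ((real l + s) * (real l + s + 1))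
    = 2 * gamma_ratio ((real l + s + real m + 1) / 2) * gamma_ratio ((real l + s - real m + 1) / 2)
        * tan (pi * ((real l + s - real m) / 2))"
proof -
  have notint: "real l + s - real k \<notin> \<int>" for k
  proof
    assume "real l + s - real k \<in> \<int>"
    then have "(real l + s - real k) - real l + real k \<in> \<int>"
      by (intro Ints_add Ints_diff) auto
    then have "s \<in> \<int>" by simp
    then show False using assms by (auto elim!: Ints_cases)
  qed
  have "real l + s \<notin> \<int>" using notint[of 0] by simp
  moreover have "gamma_ratio ((real m - (real l + s)) / 2)
      = - tan (pi * ((real l + s - real m) / 2)) * gamma_ratio ((real l + s - real m + 1) / 2)"
  proof -
    have eqs: "(real m - (real l + s)) / 2 = - ((real l + s - real m) / 2)"
      "(real l + s - real m + 1) / 2 = (real l + s - real m) / 2 + 1 / 2"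
      by (simp_all add: field_simps)
    have "2 * ((real l + s - real m) / 2) = real l + s - real m" by (simp add: field_simps)
    then have "2 * ((real l + s - real m) / 2) \<notin> \<int>" using notint[of m] by metis
    then show ?thesis
      unfolding eqs by (rule gamma_ratio_reflection)
  qed
  ultimately show ?thesis
    using equator_ratio_eq[of "real l + s" m] assms by (simp add: add_ac)
qed

lemma robin_root_iff:
  assumes "m \<le> l" "0 < s" "s < 1"
  shows "robin_root \<sigma> m ((real l + s) * (real l + s + 1)) \<longleftrightarrow>
    2 * gamma_ratio ((real l + s + real m + 1) / 2) * gamma_ratio ((real l + s - real m + 1) / 2)
        * tan (pi * ((real l + s - real m) / 2)) = \<sigma>"
proof -
  have "(real l + s) * (real l + s + 1) \<noteq> real k * (real k + 1)" for k
  proof (cases "k \<le> l")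
    case True
    then have "real k * (real k + 1) < (real l + s) * (real l + s + 1)"
      using assms by (intro mult_strict_mono) auto
    then show ?thesis by simp
  next
    case False
    then have "real k \<ge> real l + 1" by simp
    then have "(real l + s) * (real l + s + 1) < real k * (real k + 1)"
      using assms by (intro mult_strict_mono) auto
    then show ?thesis by simp
  qed
  then have "equator_value m ((real l + s) * (real l + s + 1)) \<noteq> 0"
    using equator_data_off_levels by blast
  then show ?thesis
    unfolding equator_ratio_tan[OF assms, symmetric] robin_root_def by (simp add: field_simps)
qed

lemma robin_root_even_iff:
  assumes "m \<le> l" "even (l + m)" "0 < s" "s < 1"
  shows "robin_root \<sigma> m ((real l + s) * (real l + s + 1)) \<longleftrightarrow> robin_ratio m l s = \<sigma>"
  unfolding robin_root_iff[OF assms(1,3,4)] robin_ratio_def tan_parity(1)[OF assms(1,2)] ..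

lemma level_coordinate:
  fixes \<mu> :: real
  assumes "0 < \<mu>"
  obtains \<nu> where "0 < \<nu>" "\<mu> = \<nu> * (\<nu> + 1)"
proof
  have "1 < sqrt (1 + 4 * \<mu>)" using assms by simp
  then show "0 < (sqrt (1 + 4 * \<mu>) - 1) / 2" by simp
  have "(sqrt (1 + 4 * \<mu>) - 1) / 2 * ((sqrt (1 + 4 * \<mu>) - 1) / 2 + 1) = ((sqrt (1 + 4 * \<mu>))\<^sup>2 - 1) / 4"
    by (simp add: power2_eq_square field_simps)
  then show "\<mu> = (sqrt (1 + 4 * \<mu>) - 1) / 2 * ((sqrt (1 + 4 * \<mu>) - 1) / 2 + 1)"
    using assms by simp
qed

lemma level_coordinate_less_iff:
  assumes "0 \<le> x" "0 \<le> (y::real)"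
  shows "x * (x + 1) < y * (y + 1) \<longleftrightarrow> x < y"
proof
  assume "x < y" then show "x * (x + 1) < y * (y + 1)"
    using assms by (intro mult_strict_mono) auto
next
  show "x < y" if "x * (x + 1) < y * (y + 1)"
  proof (rule ccontr)
    assume "\<not> x < y"
    then have "y * (y + 1) \<le> x * (x + 1)" using assms by (intro mult_mono) auto
    with that show False by simp
  qed
qed

text \<open>No root can lie at or below \<open>m(m + 1)\<close>, where the slope is nonpositive and the value positive, nor at
a level. In an interval \<open>(l, l + 1)\<close> of the wrong parity the tangent is negative, which \<open>\<sigma> > 0\<close>
excludes.\<close>
lemma robin_root_localize:
  assumes "0 < \<sigma>" "robin_root \<sigma> m \<mu>"
  obtains l s where "m \<le> l" "even (l + m)" "0 < s" "s < 1" "\<mu> = (real l + s) * (real l + s + 1)"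
proof -
  have "\<mu> > real m * (real m + 1)"
  proof (rule ccontr)
    assume "\<not> ?thesis"
    then have le: "\<mu> \<le> real m * (real m + 1)" by simp
    have "\<sigma> * equator_value m \<mu> > 0"
      using equator_value_ge_1[OF le] assms(1) by simp
    then show False
      using assms(2) equator_slope_nonpos[OF le] by (simp add: robin_root_def)
  qed
  moreover from this have "\<mu> > 0"
    by (smt (verit) mult_nonneg_nonneg of_nat_0_le_iff)
  then obtain \<nu> where \<nu>: "0 < \<nu>" "\<mu> = \<nu> * (\<nu> + 1)" by (rule level_coordinate)
  ultimately have "real m < \<nu>" using level_coordinate_less_iff[of "real m" \<nu>] by simp
  define l where "l = nat \<lfloor>\<nu>\<rfloor>"
  define s where "s = \<nu> - real l"
  have l: "m \<le> l" using \<open>real m < \<nu>\<close> unfolding l_def by linarith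
  have s: "0 \<le> s" "s < 1" using \<nu>(1) unfolding s_def l_def by linarith+
  have \<mu>: "\<mu> = (real l + s) * (real l + s + 1)" by (simp add: \<nu> s_def)
  have "s \<noteq> 0"
  proof
    assume "s = 0"
    then have "robin_root \<sigma> m (real l * (real l + 1))" using assms(2) \<mu> by simp
    then show False
      using equator_data_at_level[OF l] assms(1) by (auto simp: robin_root_def)
  qed
  then have s0: "0 < s" using s by simp
  have "even (l + m)"
  proof (rule ccontr)
    assume odd: "odd (l + m)"
    define t where "t = tan (pi / 2 * (1 - s))"
    have "0 < t" unfolding t_def using s0 s by (intro tan_gt_zero) (auto simp: field_simps)
    have "tan (pi / 2 * (s + 1)) = tan (- (pi / 2 * (1 - s)) + real 1 * pi)"
      by (rule arg_cong[of _ _ tan]) (simp add: field_simps)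
    also have "\<dots> = - t" by (simp only: tan_periodic_nat tan_minus t_def)
    finally have tan: "tan (pi / 2 * (s + 1)) = - t" .
    have "2 * gamma_ratio ((real l + s + real m + 1) / 2) * gamma_ratio ((real l + s - real m + 1) / 2) * (- t) = \<sigma>"
      using assms(2) robin_root_iff[OF l s0 s(2)] unfolding \<mu> tan_parity(2)[OF l odd] tan by blast
    moreover have "gamma_ratio ((real l + s + real m + 1) / 2) > 0" "gamma_ratio ((real l + s - real m + 1) / 2) > 0"
      using l s by (auto intro!: gamma_ratio_pos)
    then have "2 * gamma_ratio ((real l + s + real m + 1) / 2) * gamma_ratio ((real l + s - real m + 1) / 2) * t > 0"
      using \<open>0 < t\<close> by simp
    ultimately show False using assms(1) by simp
  qed
  then show ?thesis using that l s0 s \<mu> by blast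
qed

lemma robin_ratio_strict_mono:
  assumes "m \<le> l" "0 < s" "s < s'" "s' < 1"
  shows "robin_ratio m l s < robin_ratio m l s'"
proof -
  have "0 < tan (pi / 2 * s)" using assms by (intro tan_gt_zero) (auto simp: field_simps)
  moreover have "tan (pi / 2 * s) < tan (pi / 2 * s')"
    using assms by (intro tan_monotone) (auto simp: field_simps intro: less_trans[of _ 0])
  moreover have "0 < gamma_ratio ((real l + s + real m + 1) / 2)" "0 < gamma_ratio ((real l + s - real m + 1) / 2)"
    using assms by (auto intro!: gamma_ratio_pos)
  moreover have "gamma_ratio ((real l + s + real m + 1) / 2) \<le> gamma_ratio ((real l + s' + real m + 1) / 2)"
    "gamma_ratio ((real l + s - real m + 1) / 2) \<le> gamma_ratio ((real l + s' - real m + 1) / 2)"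
    using assms by (auto intro!: gamma_ratio_mono)
  ultimately show ?thesis
    unfolding robin_ratio_def by (intro mult_le_less_imp_less mult_mono) (auto intro!: mult_pos_pos)
qed

text \<open>The bound \<open>G(x) \<ge> \<surd>(x/2)\<close> for \<open>x \<ge> 1/2\<close>, applied to both factors. The second argument may be as
small as \<open>1/2\<close> when \<open>m = l\<close>, so only the first factor contributes \<open>\<surd>l\<close>; this is what makes the
estimate uniform in \<open>m\<close>.\<close>
lemma robin_ratio_ge:
  assumes "m \<le> l" "0 \<le> s" "s < 1"
  shows "sqrt (real l + 1) / 2 * tan (pi / 2 * s) \<le> robin_ratio m l s"
proof -
  have "0 \<le> tan (pi / 2 * s)"
    using assms tan_gt_zero[of "pi / 2 * s"] by (cases "s = 0") (auto simp: field_simps)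
  have low: "sqrt (x / 2) \<le> gamma_ratio x" if "x \<ge> 1 / 2" for x
  proof -
    have "sqrt (x / 2) * sqrt (x + 1 / 2) \<le> sqrt (x / 2) * sqrt (2 * x)"
      using that by (intro mult_left_mono) auto
    also have "\<dots> = x" using that by (simp flip: real_sqrt_mult)
    finally have "sqrt (x / 2) \<le> x / sqrt (x + 1 / 2)" using that by (simp add: field_simps)
    also have "\<dots> \<le> gamma_ratio x" using that by (intro gamma_ratio_ge) simp
    finally show ?thesis .
  qed
  have "sqrt (real l + 1) / 2 = sqrt ((real l + 1) / 2 / 2)"
    by (simp add: real_sqrt_divide)
  also have "\<dots> \<le> sqrt ((real l + s + real m + 1) / 2 / 2)" using assms by simp
  also have "\<dots> \<le> gamma_ratio ((real l + s + real m + 1) / 2)" using assms by (intro low) auto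
  finally have a: "sqrt (real l + 1) / 2 \<le> gamma_ratio ((real l + s + real m + 1) / 2)" .
  have "1 / 2 = sqrt (1 / 2 / 2)" by (simp add: real_sqrt_divide)
  also have "\<dots> \<le> gamma_ratio (1 / 2)" by (rule low) simp
  also have "\<dots> \<le> gamma_ratio ((real l + s - real m + 1) / 2)" using assms by (intro gamma_ratio_mono) auto
  finally have b: "1 / 2 \<le> gamma_ratio ((real l + s - real m + 1) / 2)" .
  have "sqrt (real l + 1) / 2 * (1 / 2)
      \<le> gamma_ratio ((real l + s + real m + 1) / 2) * gamma_ratio ((real l + s - real m + 1) / 2)"
    by (intro mult_mono a b order_trans[OF _ a]) auto
  then have "2 * (sqrt (real l + 1) / 2 * (1 / 2)) * tan (pi / 2 * s)
      \<le> 2 * (gamma_ratio ((real l + s + real m + 1) / 2) * gamma_ratio ((real l + s - real m + 1) / 2))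
        * tan (pi / 2 * s)"
    using \<open>0 \<le> tan (pi / 2 * s)\<close> by (intro mult_right_mono) auto
  then show ?thesis
    unfolding robin_ratio_def by (simp add: mult.assoc)
qed

lemma continuous_on_robin_ratio:
  assumes "m \<le> l" "s' < 1"
  shows "continuous_on {0..s'} (robin_ratio m l)"
proof -
  have "cos (pi / 2 * s) \<noteq> 0" if "s \<in> {0..s'}" for s
  proof -
    have "pi / 2 * s < pi / 2" "- (pi / 2) < pi / 2 * s"
      using that assms(2) by (auto simp: field_simps intro: less_le_trans[of _ 0])
    then show ?thesis using cos_gt_zero_pi by fastforce
  qed
  then show ?thesis
    unfolding robin_ratio_def
    by (intro continuous_intros continuous_on_compose2[OF continuous_on_gamma_ratio]) (use assms in auto)
qed

text \<open>Intermediate value theorem: the quotient is \<open>0\<close> at \<open>s = 0\<close>, and it exceeds \<open>\<sigma>\<close> where the tangent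
equals \<open>2\<sigma>\<close>.\<close>
lemma robin_ratio_solution:
  assumes "0 < \<sigma>" "m \<le> l"
  obtains s where "0 < s" "s < 1" "robin_ratio m l s = \<sigma>"
proof -
  define s' where "s' = 2 / pi * arctan (2 * \<sigma>)"
  have s': "0 < s'" "s' < 1"
    using assms(1) arctan_ubound[of "2 * \<sigma>"] by (auto simp: s'_def field_simps)
  have "tan (pi / 2 * s') = 2 * \<sigma>" by (simp add: s'_def tan_arctan)
  then have "\<sigma> \<le> sqrt (real l + 1) / 2 * tan (pi / 2 * s')"
    using assms(1) mult_right_mono[of 1 "sqrt (real l + 1)" \<sigma>] by simp
  also have "\<dots> \<le> robin_ratio m l s'" using assms s' by (intro robin_ratio_ge) auto
  finally have "\<sigma> \<le> robin_ratio m l s'" .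
  moreover have r0: "robin_ratio m l 0 = 0" by (simp add: robin_ratio_def)
  ultimately obtain s where s: "0 \<le> s" "s \<le> s'" "robin_ratio m l s = \<sigma>"
    using IVT'[of "robin_ratio m l" 0 \<sigma> s'] continuous_on_robin_ratio[OF assms(2) s'(2)] assms(1) s'(1)
    by auto
  moreover have "s \<noteq> 0" using s(3) r0 assms(1) by auto
  ultimately show ?thesis using s'(2) by (intro that[of s]) auto
qed

theorem robin_root_exists_unique:
  assumes "0 < \<sigma>" "m \<le> l" "even (l + m)"
  shows "\<exists>!\<mu>. real l * (real l + 1) < \<mu> \<and> \<mu> < (real l + 1) * (real l + 2) \<and> robin_root \<sigma> m \<mu>"
proof -
  obtain s where s: "0 < s" "s < 1" "robin_ratio m l s = \<sigma>"
    using robin_ratio_solution[OF assms(1,2)] .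
  show ?thesis
  proof (rule ex1I[of _ "(real l + s) * (real l + s + 1)"])
    show "real l * (real l + 1) < (real l + s) * (real l + s + 1)
        \<and> (real l + s) * (real l + s + 1) < (real l + 1) * (real l + 2)
        \<and> robin_root \<sigma> m ((real l + s) * (real l + s + 1))"
      using s robin_root_even_iff[OF assms(2,3) s(1,2)] by (auto intro!: mult_strict_mono)
  next
    fix \<mu> assume \<mu>: "real l * (real l + 1) < \<mu> \<and> \<mu> < (real l + 1) * (real l + 2) \<and> robin_root \<sigma> m \<mu>"
    then have "0 < \<mu>" by (smt (verit) mult_nonneg_nonneg of_nat_0_le_iff)
    then obtain \<nu> where \<nu>: "0 < \<nu>" "\<mu> = \<nu> * (\<nu> + 1)" by (rule level_coordinate)
    define t where "t = \<nu> - real l"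
    have t: "0 < t" "t < 1"
      using \<mu> \<nu> level_coordinate_less_iff[of "real l" \<nu>] level_coordinate_less_iff[of \<nu> "real l + 1"]
      by (auto simp: t_def add.assoc)
    have "\<mu> = (real l + t) * (real l + t + 1)" by (simp add: t_def \<nu>)
    moreover from this have "robin_ratio m l t = \<sigma>"
      using \<mu> robin_root_even_iff[OF assms(2,3) t] by simp
    then have "t = s"
      using robin_ratio_strict_mono[OF assms(2), of s t] robin_ratio_strict_mono[OF assms(2), of t s] s t
      by (metis less_irrefl linorder_neqE_linordered_idom)
    ultimately show "\<mu> = (real l + s) * (real l + s + 1)" by simp
  qed
qed

text \<open>From \<open>\<sigma> = q \<ge> \<surd>(l + 1) s / 2\<close> follows \<open>s = O(1/\<surd>l)\<close>, and \<open>\<mu> - l(l + 1)\<close> is about \<open>2 l s\<close>.\<close>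
theorem robin_root_cluster:
  assumes "0 < \<sigma>" "robin_root \<sigma> m \<mu>"
  obtains l where "m \<le> l" "even (l + m)" "real l * (real l + 1) < \<mu>" "\<mu> < (real l + 1) * (real l + 2)"
    "\<mu> \<le> real l * (real l + 1) + 4 * \<sigma> * sqrt (real l + 1)"
proof -
  obtain l s where l: "m \<le> l" "even (l + m)" and s: "0 < s" "s < 1"
    and \<mu>: "\<mu> = (real l + s) * (real l + s + 1)"
    using robin_root_localize[OF assms] .
  have "s \<le> pi / 2 * s" using s pi_gt3 by simp
  also have "\<dots> \<le> tan (pi / 2 * s)"
  proof -
    have "arctan (tan (pi / 2 * s)) = pi / 2 * s"
      using s by (intro arctan_tan) (auto simp: field_simps intro: less_trans[of _ 0])
    moreover have "0 \<le> tan (pi / 2 * s)"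
      using s by (intro less_imp_le tan_gt_zero) (auto simp: field_simps)
    ultimately show ?thesis using arctan_le_self by metis
  qed
  finally have "sqrt (real l + 1) / 2 * s \<le> sqrt (real l + 1) / 2 * tan (pi / 2 * s)"
    by (intro mult_left_mono) auto
  also have "\<dots> \<le> robin_ratio m l s" using l s by (intro robin_ratio_ge) auto
  also have "\<dots> = \<sigma>" using assms(2) robin_root_even_iff[OF l s] \<mu> by simp
  finally have "s * sqrt (real l + 1) \<le> 2 * \<sigma>" by (simp add: mult.commute)
  then have "(s * sqrt (real l + 1)) * (2 * sqrt (real l + 1)) \<le> (2 * \<sigma>) * (2 * sqrt (real l + 1))"
    by (intro mult_right_mono) auto
  also have "(s * sqrt (real l + 1)) * (2 * sqrt (real l + 1)) = s * (2 * real l + 2)"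
    by (simp add: algebra_simps)
  finally have "s * (2 * real l + 2) \<le> 4 * \<sigma> * sqrt (real l + 1)" by simp
  moreover have "\<mu> = real l * (real l + 1) + s * (2 * real l + 1 + s)"
    by (simp add: \<mu> algebra_simps)
  moreover have "s * (2 * real l + 1 + s) \<le> s * (2 * real l + 2)"
    using s by (intro mult_left_mono) auto
  ultimately have "\<mu> \<le> real l * (real l + 1) + 4 * \<sigma> * sqrt (real l + 1)" by linarith
  moreover have "real l * (real l + 1) < \<mu>" "\<mu> < (real l + 1) * (real l + 2)"
    unfolding \<mu> using s by (auto intro!: mult_strict_mono)
  ultimately show ?thesis using that l by blast
qed

section \<open>The polar equation\<close>

definition polar_sol :: "nat \<Rightarrow> real \<Rightarrow> real \<Rightarrow> real" where
  "polar_sol m \<mu> \<theta> = sin \<theta> ^ m * legendre_sol m \<mu> (1 - cos \<theta>)"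

text \<open>This is \<open>sin \<theta>\<close> times the \<open>\<theta>\<close>-derivative of the solution. Written without a division it is
continuous on the closed interval and vanishes at the pole.\<close>
definition polar_flux :: "nat \<Rightarrow> real \<Rightarrow> real \<Rightarrow> real" where
  "polar_flux m \<mu> \<theta> = real m * cos \<theta> * polar_sol m \<mu> \<theta>
     - raising_const m \<mu> * sin \<theta> * polar_sol (Suc m) \<mu> \<theta>"

lemma one_minus_cos_less_2:
  assumes "0 \<le> \<theta>" "\<theta> < pi"
  shows "\<bar>1 - cos \<theta>\<bar> < 2"
proof -
  have "cos pi < cos \<theta>" using assms by (intro cos_monotone_0_pi) auto
  then show ?thesis using cos_le_one[of \<theta>] by simp
qed

lemma continuous_on_legendre_sol: "continuous_on {t. \<bar>t\<bar> < 2} (legendre_sol m \<mu>)"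
  by (rule DERIV_continuous_on[OF DERIV_subset[OF legendre_sol_deriv]]) auto

lemma polar_sol_deriv:
  assumes "0 < \<theta>" "\<theta> < pi"
  shows "(polar_sol m \<mu> has_real_derivative polar_flux m \<mu> \<theta> / sin \<theta>) (at \<theta>)"
proof -
  have sin: "sin \<theta> > 0" using assms by (intro sin_gt_zero)
  have t: "\<bar>1 - cos \<theta>\<bar> < 2" using assms by (intro one_minus_cos_less_2) auto
  have "((\<lambda>x. legendre_sol m \<mu> (1 - cos x)) has_real_derivative
      - raising_const m \<mu> * legendre_sol (Suc m) \<mu> (1 - cos \<theta>) * sin \<theta>) (at \<theta>)"
    by (rule DERIV_chain2[where f = "legendre_sol m \<mu>" and g = "\<lambda>x. 1 - cos x",
          OF legendre_sol_deriv[OF t]]) (auto intro!: derivative_eq_intros)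
  note this [derivative_intros]
  have "(polar_sol m \<mu> has_real_derivative
      real m * sin \<theta> ^ (m - 1) * cos \<theta> * legendre_sol m \<mu> (1 - cos \<theta>)
      - sin \<theta> ^ m * (raising_const m \<mu> * legendre_sol (Suc m) \<mu> (1 - cos \<theta>) * sin \<theta>)) (at \<theta>)"
    unfolding polar_sol_def[abs_def]
    by (auto intro!: derivative_eq_intros simp: algebra_simps)
  also have "real m * sin \<theta> ^ (m - 1) = real m * sin \<theta> ^ m / sin \<theta>"
    using sin by (cases m) auto
  also have "real m * sin \<theta> ^ m / sin \<theta> * cos \<theta> * legendre_sol m \<mu> (1 - cos \<theta>)
      - sin \<theta> ^ m * (raising_const m \<mu> * legendre_sol (Suc m) \<mu> (1 - cos \<theta>) * sin \<theta>)
      = polar_flux m \<mu> \<theta> / sin \<theta>"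
    using sin unfolding polar_flux_def polar_sol_def by (simp add: field_simps)
  finally show ?thesis .
qed

text \<open>The polar part of the eigenvalue equation. The ladder relations express the derivative of the flux by
the solutions for \<open>m\<close> and \<open>m + 1\<close>, and the terms with \<open>m + 1\<close> cancel.\<close>
lemma polar_flux_deriv:
  assumes "0 < \<theta>" "\<theta> < pi"
  shows "(polar_flux m \<mu> has_real_derivative
      ((real m)\<^sup>2 / sin \<theta> - \<mu> * sin \<theta>) * polar_sol m \<mu> \<theta>) (at \<theta>)"
proof -
  have sin: "sin \<theta> > 0" using assms by (intro sin_gt_zero)
  have t: "\<bar>1 - cos \<theta>\<bar> < 2" using assms by (intro one_minus_cos_less_2) auto
  let ?c = "raising_const m \<mu>" and ?d = "raising_const (Suc m) \<mu>"
  let ?u = "polar_sol m \<mu> \<theta>" and ?v = "polar_sol (Suc m) \<mu> \<theta>" and ?w = "polar_sol (Suc (Suc m)) \<mu> \<theta>"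
  note polar_sol_deriv[OF assms, derivative_intros]
  have D: "(polar_flux m \<mu> has_real_derivative
      (real m * (cos \<theta> * (polar_flux m \<mu> \<theta> / sin \<theta>) - sin \<theta> * ?u)
        - ?c * (polar_flux (Suc m) \<mu> \<theta> + cos \<theta> * ?v))) (at \<theta>)"
    unfolding polar_flux_def[of m, abs_def] using sin
    by (auto intro!: derivative_eq_intros simp: algebra_simps polar_flux_def[of m])
  have "(1 - cos \<theta>) * (2 - (1 - cos \<theta>)) = (sin \<theta>)\<^sup>2"
    by (simp add: sin_squared_eq power2_eq_square algebra_simps)
  then have "(sin \<theta>)\<^sup>2 * ?d * legendre_sol (Suc (Suc m)) \<mu> (1 - cos \<theta>)
      = 2 * real (m + 1) * (cos \<theta> * legendre_sol (Suc m) \<mu> (1 - cos \<theta>) - legendre_sol m \<mu> (1 - cos \<theta>))"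
    using legendre_sol_lowering[OF t, of m \<mu>] by simp
  from arg_cong[OF this, of "\<lambda>x. x * sin \<theta> ^ Suc m"]
  have low: "?d * (sin \<theta> * ?w) = 2 * real (m + 1) * (cos \<theta> * ?v - sin \<theta> * ?u)"
    unfolding polar_sol_def by (simp add: algebra_simps power2_eq_square)
  have flux': "polar_flux (Suc m) \<mu> \<theta> = 2 * real (m + 1) * sin \<theta> * ?u - real (m + 1) * cos \<theta> * ?v"
    unfolding polar_flux_def using low by (simp add: algebra_simps)
  have c: "2 * real (m + 1) * ?c = \<mu> - real m * (real m + 1)"
    by (rule two_raising_const)
  have "real m * (cos \<theta> * (polar_flux m \<mu> \<theta> / sin \<theta>) - sin \<theta> * ?u)
        - ?c * (polar_flux (Suc m) \<mu> \<theta> + cos \<theta> * ?v)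
      = (real m)\<^sup>2 * ((cos \<theta>)\<^sup>2 / sin \<theta>) * ?u - real m * sin \<theta> * ?u - (2 * real (m + 1) * ?c) * sin \<theta> * ?u"
    unfolding flux' unfolding polar_flux_def using sin
    by (simp add: field_simps power2_eq_square)
  also have "\<dots> = ((real m)\<^sup>2 / sin \<theta> - \<mu> * sin \<theta>) * ?u"
    unfolding c cos_squared_eq using sin by (simp add: field_simps power2_eq_square)
  finally show ?thesis using D by simp
qed

lemma polar_sol_equator: "polar_sol m \<mu> (pi / 2) = equator_value m \<mu>"
  by (simp add: polar_sol_def equator_value_def)

lemma polar_flux_equator: "polar_flux m \<mu> (pi / 2) = - equator_slope m \<mu>"
  by (simp add: polar_flux_def polar_sol_equator equator_slope_def)

lemma polar_flux_pole: "polar_flux m \<mu> 0 = 0"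
  by (cases m) (simp_all add: polar_flux_def polar_sol_def)

lemma continuous_on_polar_sol: "continuous_on {0..pi / 2} (polar_sol m \<mu>)"
proof -
  have "\<bar>1 - cos \<theta>\<bar> < 2" if "\<theta> \<in> {0..pi / 2}" for \<theta>
  proof (rule one_minus_cos_less_2)
    show "0 \<le> \<theta>" using that by simp
    show "\<theta> < pi" by (rule le_less_trans[of _ "pi / 2"]) (use that in auto)
  qed
  then have "(\<lambda>\<theta>. 1 - cos \<theta>) ` {0..pi / 2} \<subseteq> {t. \<bar>t\<bar> < 2}" by blast
  then have "continuous_on {0..pi / 2} (\<lambda>\<theta>. legendre_sol m \<mu> (1 - cos \<theta>))"
    by (intro continuous_on_compose2[OF continuous_on_legendre_sol] continuous_intros)
  then show ?thesis
    unfolding polar_sol_def by (intro continuous_intros)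
qed

lemma continuous_on_polar_flux: "continuous_on {0..pi / 2} (polar_flux m \<mu>)"
  unfolding polar_flux_def by (intro continuous_intros continuous_on_polar_sol)

section \<open>Twice continuously differentiable functions\<close>

text \<open>Only one derivative is recorded, so that \<open>C2_on\<close> becomes \<open>C1_on\<close> of the derivative and closure
properties of \<open>C2_on\<close> follow from those of \<open>C1_on\<close> in the operator spaces.\<close>
definition C1_on :: "('a::real_normed_vector) set \<Rightarrow> ('a \<Rightarrow> 'b::real_normed_vector) \<Rightarrow> bool" where
  "C1_on U f \<longleftrightarrow> (\<exists>f' :: 'a \<Rightarrow> 'a \<Rightarrow>\<^sub>L 'b.
     (\<forall>x\<in>U. (f has_derivative blinfun_apply (f' x)) (at x)) \<and> continuous_on U f')"

lemma C2_on_iff: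
  "C2_on U G \<longleftrightarrow> (\<exists>G'. (\<forall>x\<in>U. (G has_derivative blinfun_apply (G' x)) (at x)) \<and> C1_on U G')"
  unfolding C2_on_def C1_on_def by blast

lemma C1_on_imp_continuous: "C1_on U f \<Longrightarrow> continuous_on U f"
  unfolding C1_on_def by (auto intro: has_derivative_continuous_on[OF has_derivative_at_withinI])

lemma C2_on_imp_C1: "C2_on U f \<Longrightarrow> C1_on U f"
  by (auto simp: C2_on_iff C1_on_def[of U f] intro: C1_on_imp_continuous)

lemma C1_on_const: "C1_on U (\<lambda>x. c)"
  unfolding C1_on_def by (auto intro!: exI[of _ "\<lambda>x. 0"] simp: zero_blinfun.rep_eq)

lemma C2_on_bounded_linear:
  assumes "bounded_linear f"
  shows "C2_on U f"
  unfolding C2_on_iff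
  by (rule exI[of _ "\<lambda>x. Blinfun f"])
    (simp add: C1_on_const bounded_linear_Blinfun_apply assms bounded_linear_imp_has_derivative)

lemma C1_on_linear_compose:
  assumes "bounded_linear L" "C1_on U f"
  shows "C1_on U (\<lambda>x. L (f x))"
proof -
  obtain f' where f': "\<And>x. x \<in> U \<Longrightarrow> (f has_derivative blinfun_apply (f' x)) (at x)" "continuous_on U f'"
    using assms(2) by (auto simp: C1_on_def)
  show ?thesis
    unfolding C1_on_def
  proof (intro exI[of _ "\<lambda>x. Blinfun L o\<^sub>L f' x"] conjI ballI)
    fix x assume "x \<in> U"
    have "blinfun_apply (Blinfun L o\<^sub>L f' x) = (\<lambda>h. L (f' x h))"
      using assms(1) by (auto simp: bounded_linear_Blinfun_apply)
    then show "((\<lambda>x. L (f x)) has_derivative blinfun_apply (Blinfun L o\<^sub>L f' x)) (at x)"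
      using bounded_linear.has_derivative[OF assms(1) f'(1)[OF \<open>x \<in> U\<close>]] by simp
  qed (intro continuous_intros f'(2))
qed

lemma C1_on_add:
  assumes "C1_on U f" "C1_on U g"
  shows "C1_on U (\<lambda>x. f x + g x)"
proof -
  obtain f' g' where
    "\<And>x. x \<in> U \<Longrightarrow> (f has_derivative blinfun_apply (f' x)) (at x)" "continuous_on U f'"
    "\<And>x. x \<in> U \<Longrightarrow> (g has_derivative blinfun_apply (g' x)) (at x)" "continuous_on U g'"
    using assms by (auto simp: C1_on_def)
  then show ?thesis
    unfolding C1_on_def
    by (intro exI[of _ "\<lambda>x. f' x + g' x"])
      (auto simp: plus_blinfun.rep_eq intro!: has_derivative_add continuous_intros)
qed

context bounded_bilinear
begin

lemma has_derivative_prod_blinfun: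
  assumes "(f has_derivative blinfun_apply f') (at x)" "(g has_derivative blinfun_apply g') (at x)"
  shows "((\<lambda>x. prod (f x) (g x)) has_derivative
    blinfun_apply ((prod_right (f x) o\<^sub>L g') + (prod_left (g x) o\<^sub>L f'))) (at x)"
proof -
  have "blinfun_apply ((prod_right (f x) o\<^sub>L g') + (prod_left (g x) o\<^sub>L f'))
      = (\<lambda>h. prod (f x) (g' h) + prod (f' h) (g x))"
    by (auto simp: blinfun.add_left)
  then show ?thesis using FDERIV[OF assms] by simp
qed

lemma C1_on_prod:
  assumes "C1_on U f" "C1_on U g"
  shows "C1_on U (\<lambda>x. prod (f x) (g x))"
proof -
  obtain f' g' where d:
    "\<And>x. x \<in> U \<Longrightarrow> (f has_derivative blinfun_apply (f' x)) (at x)" "continuous_on U f'"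
    "\<And>x. x \<in> U \<Longrightarrow> (g has_derivative blinfun_apply (g' x)) (at x)" "continuous_on U g'"
    using assms by (auto simp: C1_on_def)
  have "continuous_on U (\<lambda>x. (prod_right (f x) o\<^sub>L g' x) + (prod_left (g x) o\<^sub>L f' x))"
    by (intro continuous_intros d C1_on_imp_continuous assms
        bounded_linear.continuous_on[OF bounded_linear_prod_right]
        bounded_linear.continuous_on[OF bounded_linear_prod_left])
  then show ?thesis
    unfolding C1_on_def
    by (intro exI[of _ "\<lambda>x. (prod_right (f x) o\<^sub>L g' x) + (prod_left (g x) o\<^sub>L f' x)"] conjI ballI
        has_derivative_prod_blinfun d)
qed

end

text \<open>The derivative of a product is a sum of compositions of bounded linear maps, and composition is itself
bounded bilinear; so the product rule for \<open>C1_on\<close> applies a second time.\<close>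
lemma C2_on_prod:
  assumes "bounded_bilinear bop" "C2_on U f" "C2_on U g"
  shows "C2_on U (\<lambda>x. bop (f x) (g x))"
proof -
  interpret bounded_bilinear bop by fact
  obtain f' g' where d:
    "\<And>x. x \<in> U \<Longrightarrow> (f has_derivative blinfun_apply (f' x)) (at x)" "C1_on U f'"
    "\<And>x. x \<in> U \<Longrightarrow> (g has_derivative blinfun_apply (g' x)) (at x)" "C1_on U g'"
    using assms by (auto simp: C2_on_iff)
  have "C1_on U (\<lambda>x. (prod_right (f x) o\<^sub>L g' x) + (prod_left (g x) o\<^sub>L f' x))"
    by (intro C1_on_add bounded_bilinear.C1_on_prod[OF bounded_bilinear_blinfun_compose] d
        C1_on_linear_compose[OF bounded_linear_prod_right] C1_on_linear_compose[OF bounded_linear_prod_left]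
        C2_on_imp_C1 assms)
  then show ?thesis
    unfolding C2_on_iff
    by (intro exI[of _ "\<lambda>x. (prod_right (f x) o\<^sub>L g' x) + (prod_left (g x) o\<^sub>L f' x)"] conjI ballI
        has_derivative_prod_blinfun d)
qed

lemma C1_on_affine_compose:
  fixes \<psi> :: "real \<Rightarrow> 'b::real_normed_vector" and l :: "'a::real_normed_vector \<Rightarrow> real"
  assumes "bounded_linear l" "\<And>x. x \<in> U \<Longrightarrow> a + l x \<in> T"
    and "\<And>t. t \<in> T \<Longrightarrow> (\<psi> has_vector_derivative \<psi>' t) (at t)" "continuous_on T \<psi>'"
  shows "C1_on U (\<lambda>x. \<psi> (a + l x))"
    and "x \<in> U \<Longrightarrow> ((\<lambda>x. \<psi> (a + l x)) has_derivative
      blinfun_apply (blinfun_scaleR_left (\<psi>' (a + l x)) o\<^sub>L Blinfun l)) (at x)"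
proof -
  show D: "((\<lambda>x. \<psi> (a + l x)) has_derivative
      blinfun_apply (blinfun_scaleR_left (\<psi>' (a + l x)) o\<^sub>L Blinfun l)) (at x)" if "x \<in> U" for x
  proof -
    have "((\<lambda>x. a + l x) has_derivative l) (at x)"
      using has_derivative_add[OF has_derivative_const bounded_linear_imp_has_derivative[OF assms(1)]] by simp
    then have "((\<lambda>x. \<psi> (a + l x)) has_derivative (\<lambda>h. l h *\<^sub>R \<psi>' (a + l x))) (at x)"
      using assms(3)[OF assms(2)[OF that]]
      unfolding has_vector_derivative_def by (rule has_derivative_compose)
    moreover have "blinfun_apply (blinfun_scaleR_left (\<psi>' (a + l x)) o\<^sub>L Blinfun l) = (\<lambda>h. l h *\<^sub>R \<psi>' (a + l x))"
      using assms(1) by (auto simp: bounded_linear_Blinfun_apply)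
    ultimately show ?thesis by simp
  qed
  have "continuous_on U (\<lambda>x. \<psi>' (a + l x))"
    by (rule continuous_on_compose2[OF assms(4)])
      (use assms(1,2) in \<open>auto intro!: continuous_intros simp: linear_continuous_on\<close>)
  then have "continuous_on U (\<lambda>x. blinfun_scaleR_left (\<psi>' (a + l x)) o\<^sub>L Blinfun l)"
    by (intro continuous_intros bounded_linear.continuous_on[OF bounded_linear_blinfun_scaleR_left])
  then show "C1_on U (\<lambda>x. \<psi> (a + l x))"
    unfolding C1_on_def using D
    by (intro exI[of _ "\<lambda>x. blinfun_scaleR_left (\<psi>' (a + l x)) o\<^sub>L Blinfun l"]) simp
qed

lemma C2_on_affine_compose:
  fixes \<psi> :: "real \<Rightarrow> 'b::real_normed_vector" and l :: "'a::real_normed_vector \<Rightarrow> real"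
  assumes "bounded_linear l" "\<And>x. x \<in> U \<Longrightarrow> a + l x \<in> T"
    and "\<And>t. t \<in> T \<Longrightarrow> (\<psi> has_vector_derivative \<psi>' t) (at t)"
    and "\<And>t. t \<in> T \<Longrightarrow> (\<psi>' has_vector_derivative \<psi>'' t) (at t)" "continuous_on T \<psi>''"
  shows "C2_on U (\<lambda>x. \<psi> (a + l x))"
proof -
  have "continuous_on T \<psi>'"
    by (rule continuous_on_vector_derivative[OF has_vector_derivative_at_within[OF assms(4)]])
  note D = C1_on_affine_compose(2)[OF assms(1-3) this]
  have "C1_on U (\<lambda>x. \<psi>' (a + l x))"
    by (rule C1_on_affine_compose(1)[OF assms(1,2,4,5)])
  then have "C1_on U (\<lambda>x. blinfun_scaleR_left (\<psi>' (a + l x)) o\<^sub>L Blinfun l)"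
    by (intro bounded_bilinear.C1_on_prod[OF bounded_bilinear_blinfun_compose] C1_on_const
        C1_on_linear_compose[OF bounded_linear_blinfun_scaleR_left])
  then show ?thesis
    unfolding C2_on_iff using D
    by (intro exI[of _ "\<lambda>x. blinfun_scaleR_left (\<psi>' (a + l x)) o\<^sub>L Blinfun l"]) simp
qed

lemma C2_on_power:
  fixes f :: "'a::real_normed_vector \<Rightarrow> complex"
  assumes "C2_on U f"
  shows "C2_on U (\<lambda>x. f x ^ n)"
proof (induction n)
  case 0
  show ?case unfolding C2_on_iff by (auto intro!: exI[of _ "\<lambda>x. 0"] C1_on_const simp: zero_blinfun.rep_eq)
next
  case (Suc n)
  then show ?case using C2_on_prod[OF bounded_bilinear_mult assms] by simp
qed

section \<open>The eigenfunction of a sector\<close>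

text \<open>On the sphere \<open>(x\<^sub>1 + i x\<^sub>2)\<^sup>m\<close> equals \<open>sin\<^sup>m \<theta> exp(i m \<phi>)\<close>. As a polynomial it extends smoothly through
the pole, and the series converges near the whole closed hemisphere.\<close>
definition sector_fun :: "nat \<Rightarrow> real \<Rightarrow> real ^ 3 \<Rightarrow> complex" where
  "sector_fun m \<mu> x = Complex (x $ 1) (x $ 2) ^ m * complex_of_real (legendre_sol m \<mu> (1 + (- x $ 3)))"

lemma C2_on_sector_fun: "C2_on {x. \<bar>1 + (- x $ 3)\<bar> < 2} (sector_fun m \<mu>)"
  unfolding sector_fun_def[abs_def]
proof (rule C2_on_prod[OF bounded_bilinear_mult], rule C2_on_power, rule C2_on_bounded_linear)
  have "(\<lambda>x::real^3. Complex (x $ 1) (x $ 2)) = (\<lambda>x. of_real (x $ 1) + \<i> * of_real (x $ 2))"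
    by (auto simp: complex_eq_iff)
  then show "bounded_linear (\<lambda>x::real^3. Complex (x $ 1) (x $ 2))"
    by (auto intro!: bounded_linear_add bounded_linear_const_mult
        bounded_linear_compose[OF bounded_linear_of_real] bounded_linear_vec_nth)
  let ?T = "{t. \<bar>t\<bar> < 2}"
  have D: "((\<lambda>t. complex_of_real (legendre_sol k \<mu> t)) has_vector_derivative
      of_real (- raising_const k \<mu> * legendre_sol (Suc k) \<mu> t)) (at t)" if "t \<in> ?T" for t k
    by (intro has_vector_derivative_of_real)
      (use legendre_sol_deriv[of t k \<mu>] that in \<open>simp flip: has_real_derivative_iff_has_vector_derivative\<close>)
  show "C2_on {x. \<bar>1 + (- x $ 3)\<bar> < 2} (\<lambda>x::real^3. complex_of_real (legendre_sol m \<mu> (1 + (- x $ 3))))"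
  proof (rule C2_on_affine_compose[where T = ?T])
    show "bounded_linear (\<lambda>x::real^3. - x $ 3)"
      by (intro bounded_linear_minus bounded_linear_vec_nth)
    show "((\<lambda>t. complex_of_real (legendre_sol m \<mu> t)) has_vector_derivative
        of_real (- raising_const m \<mu>) * of_real (legendre_sol (Suc m) \<mu> t)) (at t)" if "t \<in> ?T" for t
      using D[OF that] by simp
    show "((\<lambda>t. complex_of_real (- raising_const m \<mu>) * complex_of_real (legendre_sol (Suc m) \<mu> t)) has_vector_derivative
        of_real (- raising_const m \<mu>) * of_real (- raising_const (Suc m) \<mu> * legendre_sol (Suc (Suc m)) \<mu> t)) (at t)" if "t \<in> ?T" for t
      by (intro has_vector_derivative_mult_right D that)
    show "continuous_on ?T (\<lambda>t. complex_of_real (- raising_const m \<mu>)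
        * complex_of_real (- raising_const (Suc m) \<mu> * legendre_sol (Suc (Suc m)) \<mu> t))"
      by (intro continuous_intros continuous_on_legendre_sol)
  qed auto
qed

lemma sph_components [simp]:
  "sph \<theta> \<phi> $ 1 = sin \<theta> * cos \<phi>" "sph \<theta> \<phi> $ 2 = sin \<theta> * sin \<phi>" "sph \<theta> \<phi> $ 3 = cos \<theta>"
  by (simp_all add: sph_def vector_3)

lemma norm_real3: "norm (x :: real ^ 3) = sqrt ((x $ 1)\<^sup>2 + (x $ 2)\<^sup>2 + (x $ 3)\<^sup>2)"
  by (simp add: norm_eq_sqrt_inner inner_vec_def sum_3 power2_eq_square)

lemma sph_in_hemisphere:
  assumes "0 \<le> \<theta>" "\<theta> \<le> pi / 2"
  shows "sph \<theta> \<phi> \<in> hemisphere"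
proof -
  have "(sin \<theta> * cos \<phi>)\<^sup>2 + (sin \<theta> * sin \<phi>)\<^sup>2 + (cos \<theta>)\<^sup>2
      = (sin \<theta>)\<^sup>2 * ((sin \<phi>)\<^sup>2 + (cos \<phi>)\<^sup>2) + (cos \<theta>)\<^sup>2"
    by (simp only: power_mult_distrib distrib_left)
  then show ?thesis
    using assms by (simp add: hemisphere_def norm_real3 cos_ge_zero)
qed

lemma hemisphere_cases:
  assumes "x \<in> hemisphere"
  obtains \<theta> \<phi> where "0 \<le> \<theta>" "\<theta> \<le> pi / 2" "x = sph \<theta> \<phi>"
proof -
  have x: "(x $ 1)\<^sup>2 + (x $ 2)\<^sup>2 + (x $ 3)\<^sup>2 = 1" "0 \<le> x $ 3"
    using assms by (auto simp: hemisphere_def norm_real3)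
  have "(x $ 3)\<^sup>2 \<le> 1" using x(1) by (smt (verit) zero_le_power2)
  then have x3: "x $ 3 \<le> 1" by (simp add: abs_square_le_1)
  define z where "z = Complex (x $ 1) (x $ 2)"
  have "sin (arccos (x $ 3)) = sqrt (1 - (x $ 3)\<^sup>2)"
    using x x3 by (intro sin_arccos) auto
  also have "\<dots> = cmod z" using x(1) by (simp add: z_def cmod_def)
  finally have s: "sin (arccos (x $ 3)) = cmod z" .
  have "z = rcis (cmod z) (Arg z)" by (simp add: rcis_cmod_Arg)
  then have "x $ 1 = cmod z * cos (Arg z)" "x $ 2 = cmod z * sin (Arg z)"
    by (metis Re_rcis complex.sel(1) z_def, metis Im_rcis complex.sel(2) z_def)
  then have "x = sph (arccos (x $ 3)) (Arg z)"
    using x x3 by (simp add: vec_eq_iff forall_3 s)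
  moreover have "0 \<le> arccos (x $ 3)" "arccos (x $ 3) \<le> pi / 2"
    using x x3 arccos_lbound arccos_le_pi2 by auto
  ultimately show ?thesis using that by blast
qed

lemma sector_fun_sph:
  "sector_fun m \<mu> (sph \<theta> \<phi>) = of_real (polar_sol m \<mu> \<theta>) * exp (\<i> * of_nat m * of_real \<phi>)"
proof -
  have "Complex (sin \<theta> * cos \<phi>) (sin \<theta> * sin \<phi>) = of_real (sin \<theta>) * cis \<phi>"
    by (simp add: complex_eq_iff)
  moreover have "cis \<phi> ^ m = exp (\<i> * of_nat m * of_real \<phi>)"
    by (simp add: cis_conv_exp exp_of_nat_mult[symmetric] mult_ac)
  ultimately show ?thesis
    by (simp add: sector_fun_def polar_sol_def power_mult_distrib)
qed

lemma exp_vector_derivative: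
  fixes c :: complex
  shows "((\<lambda>s. c * exp (k * of_real s)) has_vector_derivative (c * k) * exp (k * of_real t)) (at t within S)"
  by (rule has_vector_derivative_real_field) (auto intro!: derivative_eq_intros)

lemma second_exp_derivative:
  fixes c :: complex
  shows "vector_derivative (\<lambda>t. vector_derivative (\<lambda>s. c * exp (k * of_real s)) (at t)) (at \<phi>)
    = c * k\<^sup>2 * exp (k * of_real \<phi>)"
  unfolding vector_derivative_at[OF exp_vector_derivative]
  by (simp add: power2_eq_square mult.assoc)

text \<open>Value and slope never vanish together; this shows that the sector function is not identically zero.\<close>
lemma equator_value_nonzero:
  assumes "robin_root \<sigma> m \<mu>"
  shows "equator_value m \<mu> \<noteq> 0"
proof
  assume A: "equator_value m \<mu> = 0"
  then have "equator_slope m \<mu> = 0" using assms by (simp add: robin_root_def)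
  then show False
    using A equator_data_at_level[of m] equator_data_off_levels[of m \<mu>] by metis
qed

lemma sector_fun_eigenfunction:
  assumes "robin_root \<sigma> m \<mu>"
  shows "robin_eigenfunction \<sigma> \<mu> (sector_fun m \<mu>)"
  unfolding robin_eigenfunction_def
proof (intro conjI allI impI)
  have "open {x::real^3. \<bar>1 + (- x $ 3)\<bar> < 2}"
    by (intro open_Collect_less continuous_intros)
  moreover have "hemisphere \<subseteq> {x. \<bar>1 + (- x $ 3)\<bar> < 2}"
  proof
    fix x assume "x \<in> hemisphere"
    then obtain \<theta> \<phi> where "0 \<le> \<theta>" "\<theta> \<le> pi / 2" "x = sph \<theta> \<phi>" by (rule hemisphere_cases)
    then show "x \<in> {x. \<bar>1 + (- x $ 3)\<bar> < 2}"
      using one_minus_cos_less_2[of \<theta>] pi_gt_zero by simp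
  qed
  ultimately show "C2_hemisphere (sector_fun m \<mu>)"
    unfolding C2_hemisphere_def using C2_on_sector_fun by blast
next
  have "sector_fun m \<mu> (sph (pi / 2) 0) \<noteq> 0"
    using equator_value_nonzero[OF assms] by (simp add: sector_fun_sph polar_sol_equator)
  moreover have "sph (pi / 2) 0 \<in> hemisphere" by (rule sph_in_hemisphere) auto
  ultimately show "\<exists>x\<in>hemisphere. sector_fun m \<mu> x \<noteq> 0" by blast
next
  fix \<theta> \<phi> :: real assume \<theta>: "0 < \<theta> \<and> \<theta> < pi / 2"
  let ?e = "exp (\<i> * of_nat m * of_real \<phi>)"
  have "\<theta> < pi" using \<theta> pi_gt_zero by linarith
  have sin: "sin \<theta> > 0" using \<theta> \<open>\<theta> < pi\<close> by (intro sin_gt_zero) auto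
  have first: "vector_derivative (\<lambda>s. sector_fun m \<mu> (sph s \<phi>)) (at t) = of_real (polar_flux m \<mu> t / sin t) * ?e"
    if "t \<in> {0<..<pi}" for t
    unfolding sector_fun_sph
    by (rule vector_derivative_at, intro has_vector_derivative_mult_left has_vector_derivative_of_real)
      (use that polar_sol_deriv in simp)
  have "((\<lambda>t. of_real (polar_flux m \<mu> t) * ?e) has_vector_derivative
      of_real (((real m)\<^sup>2 / sin \<theta> - \<mu> * sin \<theta>) * polar_sol m \<mu> \<theta>) * ?e) (at \<theta>)"
    by (intro has_vector_derivative_mult_left has_vector_derivative_of_real)
      (use \<theta> \<open>\<theta> < pi\<close> polar_flux_deriv in simp)
  then have "((\<lambda>t. sin t *\<^sub>R vector_derivative (\<lambda>s. sector_fun m \<mu> (sph s \<phi>)) (at t)) has_vector_derivative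
      of_real (((real m)\<^sup>2 / sin \<theta> - \<mu> * sin \<theta>) * polar_sol m \<mu> \<theta>) * ?e) (at \<theta>)"
  proof (rule has_vector_derivative_transform_within_open[where S = "{0<..<pi}"])
    fix t assume t: "t \<in> {0<..<pi}"
    then have "sin t \<noteq> 0" using sin_gt_zero[of t] by auto
    then show "of_real (polar_flux m \<mu> t) * ?e
        = sin t *\<^sub>R vector_derivative (\<lambda>s. sector_fun m \<mu> (sph s \<phi>)) (at t)"
      unfolding first[OF t] by (simp add: scaleR_conv_of_real)
  qed (use \<theta> \<open>\<theta> < pi\<close> in auto)
  then have polar: "vector_derivative (\<lambda>t. sin t *\<^sub>R vector_derivative (\<lambda>s. sector_fun m \<mu> (sph s \<phi>)) (at t)) (at \<theta>)
      = of_real (((real m)\<^sup>2 / sin \<theta> - \<mu> * sin \<theta>) * polar_sol m \<mu> \<theta>) * ?e"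
    by (rule vector_derivative_at)
  have azimuth: "vector_derivative (\<lambda>t. vector_derivative (\<lambda>s. sector_fun m \<mu> (sph \<theta> s)) (at t)) (at \<phi>)
      = of_real (- (real m)\<^sup>2 * polar_sol m \<mu> \<theta>) * ?e"
    unfolding sector_fun_sph second_exp_derivative by (simp add: power_mult_distrib)
  have "laplace_beltrami (sector_fun m \<mu>) \<theta> \<phi> + of_real \<mu> * sector_fun m \<mu> (sph \<theta> \<phi>)
    = of_real (inverse (sin \<theta>) * (((real m)\<^sup>2 / sin \<theta> - \<mu> * sin \<theta>) * polar_sol m \<mu> \<theta>)
        + inverse ((sin \<theta>)\<^sup>2) * (- (real m)\<^sup>2 * polar_sol m \<mu> \<theta>) + \<mu> * polar_sol m \<mu> \<theta>) * ?e"
    unfolding laplace_beltrami_def polar azimuth unfolding sector_fun_sph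
    by (simp only: scaleR_conv_of_real mult.assoc[symmetric] of_real_mult[symmetric]
        distrib_right[symmetric] of_real_add[symmetric])
  also have "inverse (sin \<theta>) * (((real m)\<^sup>2 / sin \<theta> - \<mu> * sin \<theta>) * polar_sol m \<mu> \<theta>)
        + inverse ((sin \<theta>)\<^sup>2) * (- (real m)\<^sup>2 * polar_sol m \<mu> \<theta>) + \<mu> * polar_sol m \<mu> \<theta> = 0"
    using sin by (simp add: field_simps power2_eq_square)
  finally show "laplace_beltrami (sector_fun m \<mu>) \<theta> \<phi> + of_real \<mu> * sector_fun m \<mu> (sph \<theta> \<phi>) = 0"
    by simp
next
  fix \<phi> :: real
  let ?e = "exp (\<i> * of_nat m * of_real \<phi>)"
  have "(polar_sol m \<mu> has_real_derivative - equator_slope m \<mu>) (at (pi / 2) within {0..pi / 2})"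
    using polar_sol_deriv[of "pi / 2" m \<mu>] by (simp add: polar_flux_equator has_field_derivative_at_within)
  then have "((\<lambda>\<theta>. of_real (polar_sol m \<mu> \<theta>) * ?e) has_vector_derivative
      of_real (- equator_slope m \<mu>) * ?e) (at (pi / 2) within {0..pi / 2})"
    by (intro has_vector_derivative_mult_left has_vector_derivative_of_real)
  then have "normal_derivative (sector_fun m \<mu>) \<phi> = of_real (- equator_slope m \<mu>) * ?e"
    unfolding normal_derivative_def sector_fun_sph
    by (intro vector_derivative_within_cbox[of 0 "pi / 2", unfolded cbox_interval]) auto
  then show "normal_derivative (sector_fun m \<mu>) \<phi> + of_real \<sigma> * sector_fun m \<mu> (sph (pi / 2) \<phi>) = 0"
    using assms by (simp add: sector_fun_sph polar_sol_equator robin_root_def)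
qed

lemma sector_fun_in_sector: "in_sector (int m) (sector_fun m \<mu>)"
  unfolding in_sector_def
proof (intro exI ballI allI)
  fix \<theta> \<phi> :: real assume "\<theta> \<in> {0..pi / 2}"
  then have "arccos (cos \<theta>) = \<theta>" using pi_gt_zero by (intro arccos_cos) auto
  then show "sector_fun m \<mu> (sph \<theta> \<phi>)
      = exp (\<i> * of_int (int m) * of_real \<phi>) * (\<lambda>c. of_real (polar_sol m \<mu> (arccos c))) (cos \<theta>)"
    by (simp add: sector_fun_sph)
qed

section \<open>Every eigenfunction comes from a root\<close>

text \<open>The first-order form of the polar equation for the profile \<open>u\<close> of an arbitrary eigenfunction, with
\<open>y\<close> equal to \<open>sin t\<close> times the derivative of \<open>u\<close>. The condition at the pole is what regularity
provides.\<close>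
locale polar_solution =
  fixes m :: nat and \<mu> :: real and u y :: "real \<Rightarrow> complex"
  assumes u_deriv: "\<And>t. 0 < t \<Longrightarrow> t < pi / 2 \<Longrightarrow> (u has_vector_derivative y t /\<^sub>R sin t) (at t)"
    and y_deriv: "\<And>t. 0 < t \<Longrightarrow> t < pi / 2 \<Longrightarrow>
      (y has_vector_derivative ((real m)\<^sup>2 / sin t - \<mu> * sin t) *\<^sub>R u t) (at t)"
    and u_cont: "continuous_on {0..pi / 2} u"
    and y_cont: "continuous_on {0..pi / 2} y"
    and y_pole: "y 0 = 0"
begin

text \<open>The Wronskian with the regular solution, multiplied by \<open>sin t\<close>, is constant, and at the pole both of
its terms contain a factor that vanishes.\<close>
lemma wronskian_vanishes:
  "polar_flux m \<mu> (pi / 2) *\<^sub>R u (pi / 2) = polar_sol m \<mu> (pi / 2) *\<^sub>R y (pi / 2)"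
proof -
  let ?D = "\<lambda>t. polar_flux m \<mu> t *\<^sub>R u t - polar_sol m \<mu> t *\<^sub>R y t"
  have "?D (pi / 2) = ?D 0"
  proof (rule has_derivative_zero_unique_strong_interval[of "{0, pi / 2}" 0 "pi / 2"])
    show "continuous_on {0..pi / 2} ?D"
      by (intro continuous_intros continuous_on_polar_flux continuous_on_polar_sol u_cont y_cont)
    fix t assume t: "t \<in> {0..pi / 2} - {0, pi / 2}"
    then have t': "0 < t" "t < pi / 2" "t < pi" using pi_gt_zero by auto
    then have "sin t \<noteq> 0" using sin_gt_zero[of t] by auto
    have "(?D has_vector_derivative
        (polar_flux m \<mu> t *\<^sub>R (y t /\<^sub>R sin t) + (((real m)\<^sup>2 / sin t - \<mu> * sin t) * polar_sol m \<mu> t) *\<^sub>R u t)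
        - (polar_sol m \<mu> t *\<^sub>R (((real m)\<^sup>2 / sin t - \<mu> * sin t) *\<^sub>R u t) + (polar_flux m \<mu> t / sin t) *\<^sub>R y t)) (at t)"
      using t' by (intro has_vector_derivative_diff has_vector_derivative_scaleR polar_flux_deriv
          polar_sol_deriv u_deriv y_deriv)
    then have "(?D has_vector_derivative 0) (at t)"
      by (simp add: divide_inverse mult_ac)
    then show "(?D has_derivative (\<lambda>h. 0)) (at t within {0..pi / 2})"
      unfolding has_vector_derivative_def by (simp add: has_derivative_at_withinI)
  qed auto
  then show ?thesis by (simp add: polar_flux_pole y_pole)
qed

text \<open>Uniqueness for the initial value problem at the equator, by Gronwall's argument; the singularity of
the system at the pole forces the restriction to \<open>a > 0\<close>.\<close>
lemma vanishes_if_zero_Cauchy_data: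
  assumes "u (pi / 2) = 0" "y (pi / 2) = 0" "0 < a" "a < pi / 2"
  shows "u a = 0"
proof -
  define K where "K = 1 / sin a + ((real m)\<^sup>2 / sin a + \<bar>\<mu>\<bar>)"
  \<comment> \<open>\<open>K\<close> bounds the coefficients of the system on \<open>[a, \<pi>/2]\<close>, so the exponential factor compensates any decay
      of the energy.\<close>
  define h where "h t = (u t \<bullet> u t + y t \<bullet> y t) * exp (K * t)" for t
  have sin_a: "0 < sin a" using assms pi_gt_zero by (intro sin_gt_zero) linarith+
  have "h a \<le> h (pi / 2)"
  proof (rule DERIV_nonneg_imp_increasing_open[of a "pi / 2" h])
    show "continuous_on {a..pi / 2} h"
      unfolding h_def using assms(3)
      by (intro continuous_intros continuous_on_subset[OF u_cont] continuous_on_subset[OF y_cont]) auto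
    fix t assume t: "a < t" "t < pi / 2"
    define c where "c = (real m)\<^sup>2 / sin t - \<mu> * sin t"
    have pos: "0 < t" "t < pi" using t assms pi_gt_zero by linarith+
    have sin_t: "sin a \<le> sin t" "sin t \<le> 1"
      using t assms by (auto intro!: sin_monotone_2pi_le)
    have "((\<lambda>t. u t \<bullet> u t + y t \<bullet> y t) has_vector_derivative
        (u t \<bullet> (y t /\<^sub>R sin t) + (y t /\<^sub>R sin t) \<bullet> u t) + (y t \<bullet> (c *\<^sub>R u t) + (c *\<^sub>R u t) \<bullet> y t)) (at t)"
      unfolding c_def using t pos
      by (intro has_vector_derivative_add bounded_bilinear.has_vector_derivative[OF bounded_bilinear_inner]
          u_deriv y_deriv)
    then have "((\<lambda>t. u t \<bullet> u t + y t \<bullet> y t) has_real_derivative 2 * (1 / sin t + c) * (u t \<bullet> y t)) (at t)"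
      by (simp add: has_real_derivative_iff_has_vector_derivative inner_commute algebra_simps divide_inverse)
    moreover have "((\<lambda>t. exp (K * t)) has_real_derivative exp (K * t) * K) (at t)"
      by (auto intro!: derivative_eq_intros)
    ultimately have "(h has_real_derivative
        (2 * (1 / sin t + c) * (u t \<bullet> y t)) * exp (K * t) + (exp (K * t) * K) * (u t \<bullet> u t + y t \<bullet> y t)) (at t)"
      unfolding h_def by (rule DERIV_mult)
    moreover have "0 \<le> 2 * (1 / sin t + c) * (u t \<bullet> y t) + (u t \<bullet> u t + y t \<bullet> y t) * K"
    proof -
      have "\<bar>1 / sin t + c\<bar> \<le> K"
      proof -
        have inv: "x / sin t \<le> x / sin a" "0 \<le> x / sin t" if "0 \<le> x" for x
          using that sin_a sin_t by (auto intro!: divide_left_mono mult_pos_pos)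
        have "\<bar>\<mu> * sin t\<bar> \<le> \<bar>\<mu>\<bar>"
          using sin_a sin_t by (auto simp: abs_mult intro!: mult_left_le)
        then have "\<bar>c\<bar> \<le> (real m)\<^sup>2 / sin a + \<bar>\<mu>\<bar>"
          using abs_triangle_ineq4[of "(real m)\<^sup>2 / sin t" "\<mu> * sin t"] inv[of "(real m)\<^sup>2"]
          unfolding c_def by simp
        then show ?thesis
          using abs_triangle_ineq[of "1 / sin t" c] inv[of 1] unfolding K_def by simp
      qed
      moreover have "2 * \<bar>u t \<bullet> y t\<bar> \<le> u t \<bullet> u t + y t \<bullet> y t"
        using inner_ge_zero[of "u t - y t"] inner_ge_zero[of "u t + y t"]
        by (simp add: inner_add inner_diff inner_commute)
      ultimately have "2 * \<bar>u t \<bullet> y t\<bar> * \<bar>1 / sin t + c\<bar> \<le> (u t \<bullet> u t + y t \<bullet> y t) * K"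
        by (intro mult_mono) auto
      moreover have "- (2 * (1 / sin t + c) * (u t \<bullet> y t)) \<le> 2 * \<bar>u t \<bullet> y t\<bar> * \<bar>1 / sin t + c\<bar>"
      proof -
        have "\<bar>2 * (1 / sin t + c) * (u t \<bullet> y t)\<bar> = 2 * \<bar>u t \<bullet> y t\<bar> * \<bar>1 / sin t + c\<bar>"
          by (simp only: abs_mult abs_numeral mult_ac)
        then show ?thesis
          using abs_ge_minus_self[of "2 * (1 / sin t + c) * (u t \<bullet> y t)"] by simp
      qed
      ultimately show ?thesis by linarith
    qed
    then have "0 \<le> (2 * (1 / sin t + c) * (u t \<bullet> y t) + (u t \<bullet> u t + y t \<bullet> y t) * K) * exp (K * t)"
      by simp
    ultimately show "\<exists>D. (h has_real_derivative D) (at t) \<and> 0 \<le> D"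
      by (intro exI conjI) (assumption, simp add: algebra_simps)
  qed (use assms in auto)
  then have "u a \<bullet> u a + y a \<bullet> y a \<le> 0"
    using assms(1,2) by (simp add: h_def mult_le_0_iff)
  then show ?thesis
    by (smt (verit) inner_ge_zero inner_eq_zero_iff)
qed

end

text \<open>The vanishing Wronskian and the boundary condition give \<open>(B\<^sub>m - \<sigma> A\<^sub>m) u(\<pi>/2) = 0\<close>. If \<open>u(\<pi>/2)\<close> were
\<open>0\<close>, the Robin condition would make the derivative vanish there too, and the eigenfunction would be
identically zero.\<close>
lemma robin_root_if_eigenfunction:
  assumes F: "robin_eigenfunction \<sigma> \<mu> F" and sector: "in_sector (int m) F"
  shows "robin_root \<sigma> m \<mu>"
proof -
  obtain U G where U: "open U" "hemisphere \<subseteq> U" "C2_on U G" and FG: "\<And>x. x \<in> hemisphere \<Longrightarrow> F x = G x"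
    using F by (auto simp: robin_eigenfunction_def C2_hemisphere_def)
  obtain G' G'' where G': "\<And>x. x \<in> U \<Longrightarrow> (G has_derivative blinfun_apply (G' x)) (at x)"
    and G'': "\<And>x. x \<in> U \<Longrightarrow> (G' has_derivative blinfun_apply (G'' x)) (at x)"
    using U(3) unfolding C2_on_def by blast
  define d where "d t = cos t *\<^sub>R (axis 1 1 :: real ^ 3) - sin t *\<^sub>R axis 3 1" for t
  define u where "u t = G (sph t 0)" for t
  define y where "y t = sin t *\<^sub>R G' (sph t 0) (d t)" for t
  have sphU: "sph t 0 \<in> U" if "0 \<le> t" "t \<le> pi / 2" for t
    using sph_in_hemisphere[OF that] U(2) by blast
  have sph_eq: "(\<lambda>t. sph t 0) = (\<lambda>t. sin t *\<^sub>R axis 1 1 + cos t *\<^sub>R axis 3 1)"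
    by (auto simp: vec_eq_iff forall_3 axis_def)
  have sph_deriv: "((\<lambda>t. sph t 0) has_vector_derivative d t) (at t)" for t
    unfolding sph_eq d_def by (auto intro!: derivative_eq_intros)
  have d_deriv: "(d has_vector_derivative - sin t *\<^sub>R axis 1 1 - cos t *\<^sub>R axis 3 1) (at t)" for t
    unfolding d_def[abs_def] by (auto intro!: derivative_eq_intros)
  have u': "(u has_vector_derivative G' (sph t 0) (d t)) (at t)" if "0 \<le> t" "t \<le> pi / 2" for t
    using vector_derivative_diff_chain_within[OF sph_deriv, of G] G'[OF sphU[OF that]]
    unfolding u_def[abs_def] o_def by (simp add: has_derivative_at_withinI)
  have y': "\<exists>D. (y has_vector_derivative D) (at t)" if "0 \<le> t" "t \<le> pi / 2" for t
  proof -
    have "((\<lambda>t. G' (sph t 0)) has_vector_derivative G'' (sph t 0) (d t)) (at t)"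
      using vector_derivative_diff_chain_within[OF sph_deriv, of G'] G''[OF sphU[OF that]]
      unfolding o_def by (simp add: has_derivative_at_withinI)
    from bounded_bilinear.has_vector_derivative[OF bounded_bilinear_blinfun_apply this d_deriv]
    show ?thesis
      unfolding y_def[abs_def]
      by (intro exI) (rule has_vector_derivative_scaleR[OF DERIV_sin])
  qed
  have Fsector: "F (sph \<theta> \<phi>) = u \<theta> * exp (\<i> * of_nat m * of_real \<phi>)" if "0 \<le> \<theta>" "\<theta> \<le> pi / 2" for \<theta> \<phi>
  proof -
    obtain f where "\<forall>\<theta>\<in>{0..pi / 2}. \<forall>\<phi>. F (sph \<theta> \<phi>) = exp (\<i> * of_int (int m) * of_real \<phi>) * f (cos \<theta>)"
      using sector unfolding in_sector_def by blast
    then have f: "F (sph \<theta> \<phi>) = exp (\<i> * of_int (int m) * of_real \<phi>) * f (cos \<theta>)" for \<phi>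
      using that by simp
    have "u \<theta> = f (cos \<theta>)"
      using f[of 0] FG[OF sph_in_hemisphere[OF that]] by (simp add: u_def)
    then show ?thesis using f[of \<phi>] by simp
  qed
  have Fu: "F (sph t 0) = u t" if "0 \<le> t" "t \<le> pi / 2" for t
    using Fsector[OF that, of 0] by simp
  have y_deriv: "(y has_vector_derivative ((real m)\<^sup>2 / sin t - \<mu> * sin t) *\<^sub>R u t) (at t)"
    if t: "0 < t" "t < pi / 2" for t
  proof -
    have "sin t > 0" using t pi_gt_zero by (intro sin_gt_zero) linarith+
    obtain D where D: "(y has_vector_derivative D) (at t)" using y'[of t] t by auto
    have first: "vector_derivative (\<lambda>s. F (sph s 0)) (at s) = G' (sph s 0) (d s)"
      if "s \<in> {0<..<pi / 2}" for s
    proof (rule vector_derivative_at, rule has_vector_derivative_transform_within_open[where S = "{0<..<pi / 2}"])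
      show "(u has_vector_derivative G' (sph s 0) (d s)) (at s)" using that by (intro u') auto
    qed (use that Fu in auto)
    have "((\<lambda>s. sin s *\<^sub>R vector_derivative (\<lambda>s. F (sph s 0)) (at s)) has_vector_derivative D) (at t)"
      by (rule has_vector_derivative_transform_within_open[OF D, of "{0<..<pi / 2}"])
        (use t first in \<open>auto simp: y_def\<close>)
    then have polar: "vector_derivative (\<lambda>s. sin s *\<^sub>R vector_derivative (\<lambda>s. F (sph s 0)) (at s)) (at t) = D"
      by (rule vector_derivative_at)
    have F_eq: "(\<lambda>s. F (sph t s)) = (\<lambda>s. u t * exp (\<i> * of_nat m * of_real s))"
      using Fsector t by auto
    have azimuth: "vector_derivative (\<lambda>t'. vector_derivative (\<lambda>s. F (sph t s)) (at t')) (at 0)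
        = - ((real m)\<^sup>2 *\<^sub>R u t)"
      unfolding F_eq second_exp_derivative by (simp add: power_mult_distrib scaleR_conv_of_real mult_ac)
    have "laplace_beltrami F t 0 + of_real \<mu> * F (sph t 0) = 0"
      using F t by (simp add: robin_eigenfunction_def)
    then have "D /\<^sub>R sin t + (- ((real m)\<^sup>2 *\<^sub>R u t)) /\<^sub>R (sin t)\<^sup>2 + \<mu> *\<^sub>R u t = 0"
      unfolding laplace_beltrami_def polar azimuth using Fu t by (simp add: scaleR_conv_of_real)
    then have "D /\<^sub>R sin t = (real m)\<^sup>2 *\<^sub>R u t /\<^sub>R (sin t)\<^sup>2 - \<mu> *\<^sub>R u t"
      by (simp only: eq_iff_diff_eq_0[of "D /\<^sub>R sin t"]) (simp add: add_eq_0_iff)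
    then have "sin t *\<^sub>R (D /\<^sub>R sin t) = sin t *\<^sub>R ((real m)\<^sup>2 *\<^sub>R u t /\<^sub>R (sin t)\<^sup>2 - \<mu> *\<^sub>R u t)"
      by (rule arg_cong)
    also have "sin t *\<^sub>R (D /\<^sub>R sin t) = D"
      using \<open>sin t > 0\<close> by simp
    also have "sin t *\<^sub>R ((real m)\<^sup>2 *\<^sub>R u t /\<^sub>R (sin t)\<^sup>2 - \<mu> *\<^sub>R u t)
        = (sin t * (inverse ((sin t)\<^sup>2) * (real m)\<^sup>2) - sin t * \<mu>) *\<^sub>R u t"
      by (simp only: scaleR_diff_right scaleR_diff_left scaleR_scaleR)
    also have "sin t * (inverse ((sin t)\<^sup>2) * (real m)\<^sup>2) - sin t * \<mu> = (real m)\<^sup>2 / sin t - \<mu> * sin t"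
      using \<open>sin t > 0\<close> by (simp add: field_simps power2_eq_square)
    finally have "D = ((real m)\<^sup>2 / sin t - \<mu> * sin t) *\<^sub>R u t" .
    then show ?thesis using D by simp
  qed
  interpret polar_solution m \<mu> u y
  proof
    fix t :: real assume t: "0 < t" "t < pi / 2"
    then have "sin t > 0" using pi_gt_zero by (intro sin_gt_zero) linarith+
    then show "(u has_vector_derivative y t /\<^sub>R sin t) (at t)"
      using u'[of t] t by (simp add: y_def)
    show "(y has_vector_derivative ((real m)\<^sup>2 / sin t - \<mu> * sin t) *\<^sub>R u t) (at t)"
      by (rule y_deriv[OF t])
  next
    show "continuous_on {0..pi / 2} u"
      by (rule continuous_on_vector_derivative[OF has_vector_derivative_at_within[OF u']]) auto
    have "isCont y t" if "0 \<le> t" "t \<le> pi / 2" for t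
      using y'[OF that] has_vector_derivative_continuous by blast
    then show "continuous_on {0..pi / 2} y"
      by (intro continuous_at_imp_continuous_on) auto
    show "y 0 = 0" by (simp add: y_def)
  qed
  have "normal_derivative F 0 = y (pi / 2)"
    unfolding normal_derivative_def
  proof (rule vector_derivative_within_cbox[of 0 "pi / 2", unfolded cbox_interval])
    have "(u has_vector_derivative y (pi / 2)) (at (pi / 2) within {0..pi / 2})"
      using u'[of "pi / 2"] by (simp add: y_def has_vector_derivative_at_within)
    then show "((\<lambda>\<theta>. F (sph \<theta> 0)) has_vector_derivative y (pi / 2)) (at (pi / 2) within {0..pi / 2})"
      by (rule has_vector_derivative_transform[rotated 2]) (use Fu in auto)
  qed auto
  moreover have "normal_derivative F 0 + of_real \<sigma> * F (sph (pi / 2) 0) = 0"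
    using F by (simp add: robin_eigenfunction_def)
  ultimately have bc: "y (pi / 2) = - (\<sigma> *\<^sub>R u (pi / 2))"
    using Fu[of "pi / 2"] by (simp add: scaleR_conv_of_real eq_neg_iff_add_eq_0)
  have "u (pi / 2) \<noteq> 0"
  proof
    assume 0: "u (pi / 2) = 0"
    then have inner: "u t = 0" if "0 < t" "t \<le> pi / 2" for t
    proof (cases "t < pi / 2")
      case True
      have "y (pi / 2) = 0" using bc 0 by simp
      then show ?thesis using vanishes_if_zero_Cauchy_data[OF 0 _ that(1) True] by simp
    next
      case False
      then have "t = pi / 2" using that(2) by (rule order_antisym[rotated, OF leI])
      then show ?thesis using 0 by (simp only:)
    qed
    have "u 0 = 0"
    proof -
      have cl: "closure {0<..<pi / 2} = {0..pi / 2}"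
        by (rule closure_greaterThanLessThan) simp
      show ?thesis
        by (rule continuous_constant_on_closure[of "{0<..<pi / 2}" u], unfold cl)
          (simp_all add: u_cont inner)
    qed
    with inner have "u t = 0" if "0 \<le> t" "t \<le> pi / 2" for t
      using that by (cases "t = 0") auto
    then have "F x = 0" if x: "x \<in> hemisphere" for x
    proof -
      obtain \<theta> \<phi> where "0 \<le> \<theta>" "\<theta> \<le> pi / 2" "x = sph \<theta> \<phi>"
        using hemisphere_cases[OF x] .
      then show ?thesis using Fsector[of \<theta> \<phi>] \<open>\<And>t. 0 \<le> t \<Longrightarrow> t \<le> pi / 2 \<Longrightarrow> u t = 0\<close> by simp
    qed
    then show False using F by (auto simp: robin_eigenfunction_def)
  qed
  moreover have "(equator_slope m \<mu> - \<sigma> * equator_value m \<mu>) *\<^sub>R u (pi / 2) = 0"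
    using wronskian_vanishes by (simp add: polar_sol_equator polar_flux_equator bc scaleR_diff_left mult_ac)
  ultimately show ?thesis by (simp add: robin_root_def)
qed

text \<open>The spectral problem is thereby reduced to one scalar equation for each sector.\<close>
theorem desym_robin_spectrum_eq:
  "desym_robin_spectrum \<sigma> = {(\<mu>, int m) | \<mu> m. robin_root \<sigma> m \<mu>}"
proof (intro set_eqI iffI)
  fix p assume "p \<in> desym_robin_spectrum \<sigma>"
  then obtain \<mu> k F where p: "p = (\<mu>, k)" "0 \<le> k" "robin_eigenfunction \<sigma> \<mu> F" "in_sector k F"
    by (auto simp: desym_robin_spectrum_def)
  then obtain m where "k = int m" by (auto elim: nonneg_int_cases)
  then have "robin_root \<sigma> m \<mu>" using p by (intro robin_root_if_eigenfunction) simp_all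
  then show "p \<in> {(\<mu>, int m) | \<mu> m. robin_root \<sigma> m \<mu>}"
    unfolding \<open>p = (\<mu>, k)\<close> \<open>k = int m\<close> by blast
next
  fix p assume "p \<in> {(\<mu>, int m) | \<mu> m. robin_root \<sigma> m \<mu>}"
  then obtain \<mu> m where p: "p = (\<mu>, int m)" "robin_root \<sigma> m \<mu>" by auto
  have "0 \<le> int m \<and> (\<exists>F. robin_eigenfunction \<sigma> \<mu> F \<and> in_sector (int m) F)"
    using sector_fun_eigenfunction[OF p(2)] sector_fun_in_sector[of m \<mu>] by (intro conjI exI) simp_all
  then show "p \<in> desym_robin_spectrum \<sigma>"
    unfolding desym_robin_spectrum_def p(1) by simp
qed

section \<open>Ordered listings\<close>

text \<open>Order \<open>S\<close> lexicographically. Every element has only finitely many predecessors, so counting them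
embeds \<open>S\<close> into the natural numbers, and the image is enumerated in increasing order.\<close>
lemma ordered_listing_exists:
  fixes S :: "(real \<times> 'a::linorder) set"
  assumes "infinite S" and fin: "\<And>T. finite {p \<in> S. fst p \<le> T}"
  shows "\<exists>l. ordered_listing S l"
proof -
  define less where "less p q \<longleftrightarrow> fst p < fst q \<or> (fst p = fst q \<and> snd p < snd q)" for p q :: "real \<times> 'a"
  define rank where "rank p = card {q \<in> S. less q p}" for p
  have rank_less: "rank p < rank q" if "p \<in> S" "less p q" for p q
    unfolding rank_def
  proof (rule psubset_card_mono)
    show "finite {r \<in> S. less r q}"
      by (rule finite_subset[OF _ fin[of "fst q"]]) (auto simp: less_def)
    have "\<not> less p p" "\<And>r. less r p \<Longrightarrow> less r q"
      using that(2) by (auto simp: less_def)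
    then show "{r \<in> S. less r p} \<subset> {r \<in> S. less r q}"
      using that by blast
  qed
  have total: "p = q \<or> less p q \<or> less q p" for p q
    by (auto simp: less_def prod_eq_iff)
  have inj: "inj_on rank S"
  proof (rule inj_onI)
    fix p q assume "p \<in> S" "q \<in> S" "rank p = rank q"
    then show "p = q" using total[of p q] rank_less[of p q] rank_less[of q p] by auto
  qed
  then have infR: "infinite (rank ` S)"
    using assms(1) finite_imageD by blast
  define e where "e n = inv_into S rank (enumerate (rank ` S) n)" for n
  have bij: "bij_betw e UNIV S"
    unfolding e_def
    using bij_betw_trans[OF bij_enumerate[OF infR] bij_betw_inv_into[OF inj_on_imp_bij_betw[OF inj]]]
    by (simp add: o_def)
  have rank_e: "rank (e n) = enumerate (rank ` S) n" for n
    unfolding e_def by (rule f_inv_into_f) (rule enumerate_in_set[OF infR])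
  have eS: "e n \<in> S" for n
    using bij by (auto simp: bij_betw_def)
  have "mono (\<lambda>n. fst (e n))"
  proof (rule monoI)
    fix i j :: nat assume "i \<le> j"
    then have "rank (e i) \<le> rank (e j)"
      unfolding rank_e using enumerate_mono_le_iff[OF infR] by simp
    then have "\<not> less (e j) (e i)"
      using rank_less[OF eS] by (meson not_le)
    then show "fst (e i) \<le> fst (e j)"
      by (auto simp: less_def)
  qed
  then show ?thesis
    unfolding ordered_listing_def using bij by blast
qed

lemma ordered_listing_less_iff:
  assumes "ordered_listing S l" "finite {p \<in> S. fst p < T}"
  shows "l n < T \<longleftrightarrow> n < card {p \<in> S. fst p < T}"
proof -
  obtain e where e: "bij_betw e UNIV S" "\<And>n. l n = fst (e n)" and mono: "mono l"
    using assms(1) by (auto simp: ordered_listing_def)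
  define K where "K = {n. l n < T}"
  have "bij_betw e K {p \<in> S. fst p < T}"
    using e unfolding bij_betw_def K_def by (auto intro: inj_on_subset)
  then have card: "card K = card {p \<in> S. fst p < T}" and fin: "finite K"
    using assms(2) by (auto simp: bij_betw_same_card bij_betw_finite)
  have down: "i \<in> K" if "j \<in> K" "i \<le> j" for i j
    using that monoD[OF mono \<open>i \<le> j\<close>] by (auto simp: K_def)
  have "K = {..<card K}"
  proof (cases "K = {}")
    case False
    have "K = {..Max K}"
      using down Max_in[OF fin False] Max_ge[OF fin] by auto
    then show ?thesis
      by (metis card_atMost lessThan_Suc_atMost)
  qed simp
  then have "n \<in> K \<longleftrightarrow> n < card K" by blast
  then show ?thesis unfolding card[symmetric] by (simp add: K_def)
qed

section \<open>Clusters of eigenvalues\<close>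

text \<open>The pairs \<open>(l, m)\<close> that label the roots below the level \<open>L(L + 1)\<close>.\<close>
definition cluster_indices :: "nat \<Rightarrow> (nat \<times> nat) set" where
  "cluster_indices L = Sigma {..<L} (\<lambda>l. {m. m \<le> l \<and> even (l + m)})"

lemma card_cluster_indices_le: "card (cluster_indices L) \<le> L\<^sup>2"
proof -
  have "cluster_indices L \<subseteq> {..<L} \<times> {..<L}"
    by (auto simp: cluster_indices_def)
  then have "card (cluster_indices L) \<le> card ({..<L} \<times> {..<L})"
    by (intro card_mono) auto
  then show ?thesis by (simp add: power2_eq_square)
qed

text \<open>The cluster \<open>l\<close> contains at least the \<open>l div 2 + 1\<close> labels \<open>m = l - 2k\<close>.\<close>
lemma card_cluster_indices_ge: "L\<^sup>2 \<le> 4 * card (cluster_indices L)"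
proof -
  have fiber: "l div 2 + 1 \<le> card {m. m \<le> l \<and> even (l + m)}" for l :: nat
  proof -
    have "inj_on (\<lambda>k. l - 2 * k) {..l div 2}"
      by (rule inj_onI) auto
    then have "card ((\<lambda>k. l - 2 * k) ` {..l div 2}) = l div 2 + 1"
      by (simp add: card_image)
    moreover have "(\<lambda>k. l - 2 * k) ` {..l div 2} \<subseteq> {m. m \<le> l \<and> even (l + m)}"
    proof
      fix m assume "m \<in> (\<lambda>k. l - 2 * k) ` {..l div 2}"
      then obtain k where "k \<le> l div 2" "m = l - 2 * k" by auto
      then have "l = m + 2 * k" by presburger
      then show "m \<in> {m. m \<le> l \<and> even (l + m)}" by simp
    qed
    ultimately show ?thesis
      using card_mono[of "{m. m \<le> l \<and> even (l + m)}" "(\<lambda>k. l - 2 * k) ` {..l div 2}"] by simp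
  qed
  have "L\<^sup>2 \<le> 4 * (\<Sum>l<L. l div 2 + 1)"
  proof (induction L)
    case (Suc L)
    have "2 * L + 1 \<le> 4 * (L div 2 + 1)" by presburger
    with Suc show ?case by (simp add: power2_eq_square)
  qed simp
  also have "(\<Sum>l<L. l div 2 + 1) \<le> card (cluster_indices L)"
    unfolding cluster_indices_def by (subst card_SigmaI) (auto intro!: sum_mono fiber[simplified])
  finally show ?thesis by simp
qed

lemma level_gap: "l < l' \<Longrightarrow> (real l + 1) * (real l + 2) \<le> real l' * (real l' + 1)"
  by (intro mult_mono) auto

text \<open>Each label has exactly one root, which lies strictly between two consecutive levels, so labels and
roots correspond bijectively.\<close>
lemma robin_spectrum_below:
  assumes "0 < \<sigma>"
  shows "finite {p \<in> desym_robin_spectrum \<sigma>. fst p < real L * (real L + 1)}"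
    and "card {p \<in> desym_robin_spectrum \<sigma>. fst p < real L * (real L + 1)} = card (cluster_indices L)"
proof -
  define root where "root l m =
    (THE \<mu>. real l * (real l + 1) < \<mu> \<and> \<mu> < (real l + 1) * (real l + 2) \<and> robin_root \<sigma> m \<mu>)" for l m
  have root: "real l * (real l + 1) < root l m" "root l m < (real l + 1) * (real l + 2)" "robin_root \<sigma> m (root l m)"
    if "m \<le> l" "even (l + m)" for l m
    using theI'[OF robin_root_exists_unique[OF assms that]] unfolding root_def by auto
  have root_eq: "root l m = \<mu>"
    if "m \<le> l" "even (l + m)" "real l * (real l + 1) < \<mu>" "\<mu> < (real l + 1) * (real l + 2)" "robin_root \<sigma> m \<mu>" for l m \<mu>
    using robin_root_exists_unique[OF assms that(1,2)] root[OF that(1,2)] that(3-5) by blast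
  define g where "g = (\<lambda>(l, m). (root l m, int m))"
  have "inj_on g (cluster_indices L)"
  proof (rule inj_onI, clarify)
    fix l m l' m' assume i: "(l, m) \<in> cluster_indices L" "(l', m') \<in> cluster_indices L" "g (l, m) = g (l', m')"
    then have "m = m'" "root l m = root l' m" by (auto simp: g_def)
    moreover have "m \<le> l" "even (l + m)" "m' \<le> l'" "even (l' + m')"
      using i(1,2) by (auto simp: cluster_indices_def)
    ultimately show "l = l' \<and> m = m'"
      using root[of m l] root[of m l'] level_gap[of l l'] level_gap[of l' l] by (cases l l' rule: linorder_cases) auto
  qed
  moreover have "g ` cluster_indices L = {p \<in> desym_robin_spectrum \<sigma>. fst p < real L * (real L + 1)}"
  proof (intro set_eqI iffI)
    fix p assume "p \<in> g ` cluster_indices L"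
    then obtain l m where lm: "p = (root l m, int m)" "l < L" "m \<le> l" "even (l + m)"
      by (auto simp: g_def cluster_indices_def)
    then show "p \<in> {p \<in> desym_robin_spectrum \<sigma>. fst p < real L * (real L + 1)}"
      using root[OF lm(3,4)] level_gap[OF lm(2)] by (auto simp: desym_robin_spectrum_eq)
  next
    fix p assume "p \<in> {p \<in> desym_robin_spectrum \<sigma>. fst p < real L * (real L + 1)}"
    then obtain \<mu> m where p: "p = (\<mu>, int m)" "robin_root \<sigma> m \<mu>" "\<mu> < real L * (real L + 1)"
      by (auto simp: desym_robin_spectrum_eq)
    obtain l where l: "m \<le> l" "even (l + m)" "real l * (real l + 1) < \<mu>" "\<mu> < (real l + 1) * (real l + 2)"
      using robin_root_cluster[OF assms p(2)] by blast
    have "l < L"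
      using l(3) p(3) level_le[of L l] by (meson less_le_trans less_asym not_le)
    then have "(l, m) \<in> cluster_indices L" using l by (simp add: cluster_indices_def)
    moreover have "p = g (l, m)" using root_eq[OF l p(2)] by (simp add: g_def p(1))
    ultimately show "p \<in> g ` cluster_indices L" by blast
  qed
  moreover have "finite (cluster_indices L)"
    by (auto simp: cluster_indices_def)
  ultimately show "finite {p \<in> desym_robin_spectrum \<sigma>. fst p < real L * (real L + 1)}"
    "card {p \<in> desym_robin_spectrum \<sigma>. fst p < real L * (real L + 1)} = card (cluster_indices L)"
    by (metis finite_imageI, metis card_image)
qed

lemma robin_spectrum_listing_exists:
  assumes "0 < \<sigma>"
  shows "\<exists>l. ordered_listing (desym_robin_spectrum \<sigma>) l"
proof (rule ordered_listing_exists)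
  show "finite {p \<in> desym_robin_spectrum \<sigma>. fst p \<le> T}" for T
  proof -
    obtain L where "T < real L" using reals_Archimedean2 by blast
    moreover have "real L \<le> real L * (real L + 1)"
      using mult_left_mono[of 1 "real L + 1" "real L"] by simp
    ultimately show ?thesis
      by (intro finite_subset[OF _ robin_spectrum_below(1)[OF assms, of L]]) auto
  qed
  show "infinite (desym_robin_spectrum \<sigma>)"
  proof
    assume fin: "finite (desym_robin_spectrum \<sigma>)"
    \<comment> \<open>For this \<open>L\<close> the quadratic lower bound exceeds the supposed cardinality.\<close>
    define L where "L = 4 * card (desym_robin_spectrum \<sigma>) + 1"
    have "L\<^sup>2 \<le> 4 * card {p \<in> desym_robin_spectrum \<sigma>. fst p < real L * (real L + 1)}"
      using card_cluster_indices_ge[of L] by (simp add: robin_spectrum_below(2)[OF assms])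
    also have "\<dots> \<le> 4 * card (desym_robin_spectrum \<sigma>)"
      using fin by (intro mult_left_mono card_mono) auto
    also have "\<dots> < L" by (simp add: L_def)
    also have "L \<le> L\<^sup>2" by (simp add: power2_eq_square)
    finally show False by simp
  qed
qed

section \<open>Gaps of a clustered sequence\<close>

text \<open>The properties of the eigenvalue sequence that the gap statistics depend on. The last two say that
\<open>\<lambda>\<^sub>n\<close> is of order \<open>n\<close>: between \<open>L\<^sup>2/4\<close> and \<open>L\<^sup>2\<close> terms lie below \<open>L(L + 1)\<close>.\<close>
locale clustered_sequence =
  fixes ev :: "nat \<Rightarrow> real" and C :: real
  assumes mono: "mono ev"
    and C_nonneg: "0 \<le> C"
    and cluster: "\<And>n. \<exists>l. real l * (real l + 1) \<le> ev n \<and> ev n < (real l + 1) * (real l + 2)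
      \<and> ev n \<le> real l * (real l + 1) + C * sqrt (real l + 1)"
    and below: "\<And>n L. ev n < real L * (real L + 1) \<Longrightarrow> n < L\<^sup>2"
    and above: "\<And>n L. real L * (real L + 1) \<le> ev n \<Longrightarrow> L\<^sup>2 \<le> 4 * n"
begin

definition idx :: "nat \<Rightarrow> nat" where
  "idx n = (SOME l. real l * (real l + 1) \<le> ev n \<and> ev n < (real l + 1) * (real l + 2)
      \<and> ev n \<le> real l * (real l + 1) + C * sqrt (real l + 1))"

lemma idx:
  "real (idx n) * (real (idx n) + 1) \<le> ev n"
  "ev n < (real (idx n) + 1) * (real (idx n) + 2)"
  "ev n \<le> real (idx n) * (real (idx n) + 1) + C * sqrt (real (idx n) + 1)"
  using someI_ex[OF cluster[of n]] unfolding idx_def by auto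

lemma idx_mono: "idx n \<le> idx (Suc n)"
proof (rule ccontr)
  assume "\<not> ?thesis"
  then have "(real (idx (Suc n)) + 1) * (real (idx (Suc n)) + 2) \<le> real (idx n) * (real (idx n) + 1)"
    by (intro level_gap) simp
  then show False
    using idx(2)[of "Suc n"] idx(1)[of n] monoD[OF mono, of n "Suc n"] by simp
qed

text \<open>An upper estimate for the part of the line that the clusters cover up to the \<open>n\<close>-th term, plus one
unit for every completed cluster. It grows by at least the truncated gap in each step, so the sum of
the truncated gaps telescopes.\<close>
definition potential :: "nat \<Rightarrow> real" where
  "potential n = (\<Sum>j<idx n. C * sqrt (real j + 1) + 1) + (ev n - real (idx n) * (real (idx n) + 1))"

lemma gap_le_potential: "min 1 (ev (Suc n) - ev n) \<le> potential (Suc n) - potential n"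
proof (cases "idx n = idx (Suc n)")
  case True
  then show ?thesis by (simp add: potential_def)
next
  case False
  then have "Suc (idx n) \<le> idx (Suc n)" using idx_mono[of n] by simp
  then have "(\<Sum>j<Suc (idx n). C * sqrt (real j + 1) + 1) \<le> (\<Sum>j<idx (Suc n). C * sqrt (real j + 1) + 1)"
    using C_nonneg by (intro sum_mono2) auto
  then have "potential n + 1 \<le> potential (Suc n)"
    using idx(3)[of n] idx(1)[of "Suc n"] by (simp add: potential_def)
  then show ?thesis by simp
qed

text \<open>Since \<open>L\<^sup>2 \<le> 4n\<close> as soon as \<open>\<lambda>\<^sub>n\<close> reaches \<open>L(L + 1)\<close>, the cluster of the \<open>n\<close>-th term has an index of at
most \<open>2\<surd>n\<close>.\<close>
lemma sum_min_gap_le: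
  "(\<Sum>n = 1..N. min 1 (ev (Suc n) - ev n))
     \<le> 3 * sqrt (real N + 1) * (C * sqrt (3 * sqrt (real N + 1)) + 1)"
proof -
  define k where "k = idx (Suc N)"
  have "(\<Sum>n = 1..N. min 1 (ev (Suc n) - ev n)) \<le> (\<Sum>n = 1..N. potential (Suc n) - potential n)"
    by (intro sum_mono gap_le_potential)
  also have "\<dots> = potential (Suc N) - potential 1"
    by (subst sum_Suc_diff) auto
  also have "\<dots> \<le> potential (Suc N)"
  proof -
    have "0 \<le> (\<Sum>j<idx 1. C * sqrt (real j + 1) + 1)"
      using C_nonneg by (intro sum_nonneg) auto
    then show ?thesis using idx(1)[of 1] unfolding potential_def by linarith
  qed
  also have "\<dots> \<le> (\<Sum>j<Suc k. C * sqrt (real j + 1) + 1)"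
    using idx(3)[of "Suc N"] unfolding potential_def k_def by simp
  also have "\<dots> \<le> (\<Sum>j<Suc k. C * sqrt (real k + 1) + 1)"
    using C_nonneg by (intro sum_mono add_right_mono mult_left_mono) auto
  also have "\<dots> = (real k + 1) * (C * sqrt (real k + 1) + 1)"
    by simp
  also have "\<dots> \<le> 3 * sqrt (real N + 1) * (C * sqrt (3 * sqrt (real N + 1)) + 1)"
  proof -
    have "k\<^sup>2 \<le> 4 * Suc N"
      using idx(1)[of "Suc N"] unfolding k_def by (rule above)
    then have "(real k)\<^sup>2 \<le> 4 * (real N + 1)"
      by (metis of_nat_Suc of_nat_le_iff of_nat_mult of_nat_numeral of_nat_power add.commute)
    then have "real k \<le> sqrt (4 * (real N + 1))" by (rule real_le_rsqrt)
    also have "\<dots> = 2 * sqrt (real N + 1)" by (simp only: real_sqrt_mult real_sqrt_four)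
    finally have "real k + 1 \<le> 3 * sqrt (real N + 1)"
      using real_sqrt_ge_one[of "real N + 1"] by linarith
    then show ?thesis
      using C_nonneg by (intro mult_mono add_right_mono mult_left_mono real_sqrt_le_mono) auto
  qed
  finally show ?thesis .
qed

lemma mean_min_gap_tendsto:
  "(\<lambda>N. (\<Sum>n = 1..N. min 1 (ev (Suc n) - ev n)) / real N) \<longlonglongrightarrow> 0"
proof (rule tendsto_sandwich)
  have "0 \<le> min 1 (ev (Suc n) - ev n)" for n
    using monoD[OF mono, of n "Suc n"] by simp
  then show "\<forall>\<^sub>F N in sequentially. 0 \<le> (\<Sum>n = 1..N. min 1 (ev (Suc n) - ev n)) / real N"
    by (intro always_eventually allI divide_nonneg_nonneg sum_nonneg) auto
  show "\<forall>\<^sub>F N in sequentially. (\<Sum>n = 1..N. min 1 (ev (Suc n) - ev n)) / real N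
      \<le> 3 * sqrt (real N + 1) * (C * sqrt (3 * sqrt (real N + 1)) + 1) / real N"
    by (intro always_eventually allI divide_right_mono sum_min_gap_le) auto
  have "(\<lambda>N. C * (3 * sqrt (real N + 1) * sqrt (3 * sqrt (real N + 1)) / real N)
      + 3 * sqrt (real N + 1) / real N) \<longlonglongrightarrow> C * 0 + 0"
    by (intro tendsto_add tendsto_mult tendsto_const; real_asymp)
  then show "(\<lambda>N. 3 * sqrt (real N + 1) * (C * sqrt (3 * sqrt (real N + 1)) + 1) / real N) \<longlonglongrightarrow> 0"
    by (simp add: field_simps add_divide_distrib)
qed auto

text \<open>The gaps add up to \<open>\<lambda>\<^sub>N\<^sub>+\<^sub>1 - \<lambda>\<^sub>1\<close>, and at most \<open>L\<^sup>2\<close> terms lie below \<open>L(L + 1)\<close>, so \<open>\<lambda>\<^sub>N\<close> grows at least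
like \<open>N\<close>.\<close>
lemma mean_gap_ge_half:
  "\<forall>\<^sub>F N in sequentially. 1 / 2 \<le> (\<Sum>n = 1..N. ev (Suc n) - ev n) / real N"
proof -
  have "(\<lambda>N. ((sqrt (real N + 1) - 1) * sqrt (real N + 1) - ev 1) / real N) \<longlonglongrightarrow> 1"
    by real_asymp
  then have "\<forall>\<^sub>F N in sequentially. 1 / 2 < ((sqrt (real N + 1) - 1) * sqrt (real N + 1) - ev 1) / real N"
    by (rule order_tendstoD) simp
  then show ?thesis
  proof eventually_elim
    case (elim N)
    define k where "k = idx (Suc N)"
    have "ev (Suc N) < real (k + 1) * (real (k + 1) + 1)"
      using idx(2)[of "Suc N"] by (simp add: k_def add_ac)
    then have "Suc N < (k + 1)\<^sup>2" by (rule below)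
    then have "real (Suc N) < real ((k + 1)\<^sup>2)" by (simp only: of_nat_less_iff)
    then have "real N + 1 \<le> (real k + 1)\<^sup>2" by (simp add: add_ac)
    then have "sqrt (real N + 1) \<le> real k + 1" by (intro real_le_lsqrt) auto
    moreover have "1 \<le> sqrt (real N + 1)" by simp
    ultimately have "(sqrt (real N + 1) - 1) * sqrt (real N + 1) \<le> real k * (real k + 1)"
      by (intro mult_mono) auto
    also have "\<dots> \<le> ev (Suc N)" using idx(1) by (simp add: k_def)
    finally have "((sqrt (real N + 1) - 1) * sqrt (real N + 1) - ev 1) / real N \<le> (ev (Suc N) - ev 1) / real N"
      by (intro divide_right_mono) auto
    moreover have "(\<Sum>n = 1..N. ev (Suc n) - ev n) = ev (Suc N) - ev 1"
      by (subst sum_Suc_diff) auto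
    ultimately show ?case using elim by (metis less_imp_le less_le_trans)
  qed
qed

end

text \<open>The deviation of \<open>f\<close> from \<open>f 0\<close> is small where the normalized gap is small, and elsewhere it is bounded
by a multiple of the truncated gap, so it is controlled on average.\<close>
lemma average_tendsto_value_at_0:
  fixes f :: "real \<Rightarrow> real" and g s :: "nat \<Rightarrow> real"
  assumes cont: "continuous_on {0..} f" and bdd: "bounded (f ` {0..})"
    and g: "\<And>n. 0 \<le> g n"
    and small: "(\<lambda>N. (\<Sum>n = 1..N. min 1 (g n)) / real N) \<longlonglongrightarrow> 0"
    and s: "0 < c" "\<forall>\<^sub>F N in sequentially. c \<le> s N"
  shows "(\<lambda>N. (\<Sum>n = 1..N. f (g n / s N)) / real N) \<longlonglongrightarrow> f 0"
proof (rule tendstoI)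
  fix \<epsilon> :: real assume \<epsilon>: "0 < \<epsilon>"
  obtain M where M: "\<And>x. 0 \<le> x \<Longrightarrow> \<bar>f x\<bar> \<le> M"
    using bdd by (auto simp: bounded_iff)
  then have "0 \<le> M" using order_trans[OF abs_ge_zero M[of 0]] by simp
  have "\<exists>\<delta>>0. \<forall>x\<in>{0..}. dist x 0 < \<delta> \<longrightarrow> dist (f x) (f 0) < \<epsilon> / 2"
    using cont[unfolded continuous_on_iff, rule_format, of 0 "\<epsilon> / 2"] \<epsilon> by simp
  then obtain \<delta> where \<delta>: "0 < \<delta>" "\<And>x. 0 \<le> x \<Longrightarrow> x < \<delta> \<Longrightarrow> \<bar>f x - f 0\<bar> < \<epsilon> / 2"
    by (auto simp: dist_real_def)
  \<comment> \<open>If \<open>g n / s N \<ge> \<delta>\<close>, then \<open>g n \<ge> c \<delta>\<close>, and \<open>K * min 1 (g n)\<close> exceeds the trivial bound \<open>2 * M\<close>.\<close>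
  define K where "K = 2 * M * max 1 (1 / (c * \<delta>))"
  have "0 \<le> K" using \<open>0 \<le> M\<close> by (simp add: K_def)
  have pointwise: "\<bar>f (y / t) - f 0\<bar> \<le> \<epsilon> / 2 + K * min 1 y" if "0 \<le> y" "c \<le> t" for y t
  proof (cases "y / t < \<delta>")
    case True
    then have "\<bar>f (y / t) - f 0\<bar> < \<epsilon> / 2"
      using \<delta>(2)[of "y / t"] that s(1) by simp
    moreover have "0 \<le> K * min 1 y" using \<open>0 \<le> K\<close> that by simp
    ultimately show ?thesis by simp
  next
    case False
    have "0 < t" using that s(1) by simp
    have "\<bar>f (y / t) - f 0\<bar> \<le> 2 * M"
      using M[of "y / t"] M[of 0] that \<open>0 < t\<close> by simp
    moreover have "c * \<delta> \<le> y"
    proof -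
      have "c * \<delta> \<le> t * \<delta>" using that \<delta>(1) by simp
      also have "\<dots> \<le> y" using False \<open>0 < t\<close> by (simp add: field_simps)
      finally show ?thesis .
    qed
    then have "1 \<le> 1 / (c * \<delta>) * y" using s(1) \<delta>(1) by (simp add: field_simps)
    then have "1 \<le> max 1 (1 / (c * \<delta>)) * y"
      using mult_right_mono[OF max.cobounded2[of "1 / (c * \<delta>)" 1] that(1)] by linarith
    then have "1 \<le> max 1 (1 / (c * \<delta>)) * min 1 y"
      by (cases "y \<le> 1") auto
    then have "2 * M * 1 \<le> K * min 1 y"
      unfolding K_def mult.assoc using \<open>0 \<le> M\<close> by (intro mult_left_mono) auto
    ultimately show ?thesis using \<epsilon> by simp
  qed
  have "(\<lambda>N. K * ((\<Sum>n = 1..N. min 1 (g n)) / real N)) \<longlonglongrightarrow> K * 0"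
    by (intro tendsto_intros small)
  then have "\<forall>\<^sub>F N in sequentially. K * ((\<Sum>n = 1..N. min 1 (g n)) / real N) < \<epsilon> / 2"
    by (rule order_tendstoD) (use \<epsilon> in simp)
  with s(2) eventually_gt_at_top[of 0]
  show "\<forall>\<^sub>F N in sequentially. dist ((\<Sum>n = 1..N. f (g n / s N)) / real N) (f 0) < \<epsilon>"
  proof eventually_elim
    case (elim N)
    have "(\<Sum>n = 1..N. f (g n / s N)) / real N - f 0 = (\<Sum>n = 1..N. f (g n / s N) - f 0) / real N"
      using elim by (simp add: sum_subtractf field_simps)
    then have "\<bar>(\<Sum>n = 1..N. f (g n / s N)) / real N - f 0\<bar> = \<bar>\<Sum>n = 1..N. f (g n / s N) - f 0\<bar> / real N"
      by simp
    also have "\<dots> \<le> (\<Sum>n = 1..N. \<epsilon> / 2 + K * min 1 (g n)) / real N"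
      using elim g pointwise by (intro divide_right_mono order_trans[OF sum_abs] sum_mono) auto
    also have "\<dots> = \<epsilon> / 2 + K * ((\<Sum>n = 1..N. min 1 (g n)) / real N)"
      using elim by (simp add: sum.distrib sum_distrib_left[symmetric] add_divide_distrib)
    also have "\<dots> < \<epsilon>" using elim by linarith
    finally show ?case by (simp add: dist_real_def)
  qed
qed

section \<open>The level spacing distribution\<close>

theorem corollary1p4:
  fixes \<sigma> :: real and f :: "real \<Rightarrow> real"
  assumes "0 < \<sigma>"
    and "continuous_on {0..} f"
    and "bounded (f ` {0..})"
  shows "(\<lambda>N. (\<Sum>n = 1..N. f (robin_gap \<sigma> n / mean_robin_gap \<sigma> N)) / real N)
           \<longlonglongrightarrow> f 0"
proof -
  let ?S = "desym_robin_spectrum \<sigma>" and ?ev = "robin_eigenvalue \<sigma>"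
  obtain l where l: "ordered_listing ?S l"
    using robin_spectrum_listing_exists[OF assms(1)] by blast
  then have "?ev = l"
    unfolding robin_eigenvalue_def by (intro the_equality) (auto intro: ordered_listing_unique)
  with l have listing: "ordered_listing ?S ?ev" by simp
  have count: "?ev n < real L * (real L + 1) \<longleftrightarrow> n < card (cluster_indices L)" for n L
    using ordered_listing_less_iff[OF listing robin_spectrum_below(1)[OF assms(1)]]
      robin_spectrum_below(2)[OF assms(1)] by simp
  interpret clustered_sequence ?ev "4 * \<sigma>"
  proof
    show "mono ?ev" using listing by (simp add: ordered_listing_def)
    show "0 \<le> 4 * \<sigma>" using assms(1) by simp
  next
    fix n
    have "(\<exists>p\<in>?S. ?ev n = fst p)"
      using listing by (auto simp: ordered_listing_def bij_betw_def)
    then obtain m where "robin_root \<sigma> m (?ev n)"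
      by (auto simp: desym_robin_spectrum_eq)
    then obtain k where "real k * (real k + 1) < ?ev n" "?ev n < (real k + 1) * (real k + 2)"
      "?ev n \<le> real k * (real k + 1) + 4 * \<sigma> * sqrt (real k + 1)"
      using robin_root_cluster[OF assms(1)] by blast
    then show "\<exists>l. real l * (real l + 1) \<le> ?ev n \<and> ?ev n < (real l + 1) * (real l + 2)
        \<and> ?ev n \<le> real l * (real l + 1) + 4 * \<sigma> * sqrt (real l + 1)"
      by (intro exI[of _ k]) simp
  next
    fix n L
    show "?ev n < real L * (real L + 1) \<Longrightarrow> n < L\<^sup>2"
      using count[of n L] card_cluster_indices_le[of L] by simp
    show "real L * (real L + 1) \<le> ?ev n \<Longrightarrow> L\<^sup>2 \<le> 4 * n"
      using count[of n L] card_cluster_indices_ge[of L] by simp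
  qed
  show ?thesis
  proof (rule average_tendsto_value_at_0[OF assms(2,3)])
    show "0 \<le> robin_gap \<sigma> n" for n
      using monoD[OF mono, of n "Suc n"] by (simp add: robin_gap_def)
    show "(\<lambda>N. (\<Sum>n = 1..N. min 1 (robin_gap \<sigma> n)) / real N) \<longlonglongrightarrow> 0"
      using mean_min_gap_tendsto by (simp add: robin_gap_def)
    show "\<forall>\<^sub>F N in sequentially. 1 / 2 \<le> mean_robin_gap \<sigma> N"
      using mean_gap_ge_half by (simp add: mean_robin_gap_def robin_gap_def)
  qed simp
qed

end
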